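(* Let $\mu=\mu_{I_X,I_Y,H}$ be a Symmetric Rank Covariance, with rank indicator functions $I_X,I_Y$ of order $m$ and dimensions $r,s$, $H\le S_m$ a subgroup with equally many even and odd permutations, and invariance group $G=G_X\cap G_Y$. Suppose that for every singleton $S=\{i\}\subset\{1,\dots,m\}$ the following holds: each equivalence class of $H$ under the relation "$h\sim h'$ if there exists $g\in G$ with $gh(i)=h'(i)$" contains an equal number of even and odd permutations. If $X$ and $Y$ are independent, then $\kappa_1\equiv0$, and thus $U_\mu$ is a degenerate U-statistic, i.e. $\sqrt n\,(U_\mu(Z^{[n]})-E\,U_\mu(Z^{[n]}))\to0$ in probability as $n\to\infty$.
   Context: For $\sigma\in S_m$ and $w^{[m]}=(w^1,\dots,w^m)\in\mathbb{R}^{d\times m}$, $w^{\sigma[m]}=\sigma w^{[m]}=(w^{\sigma^{-1}(1)},\dots,w^{\sigma^{-1}(m)})$. Joint rank matrix: $\mathcal{R}(w^{[m]})_{ij}=1+\sum_{k=1}^m1_{[w^k_i<w^j_i]}$. A rank indicator function of order $m$ and dimension $d$ is a function $I:\mathbb{R}^{d\times m}\to\{0,1\}$ with $I(\mathcal{R}(w^{[m]}))=I(w^{[m]})$ for all $w^{[m]}$. The invariance group of $I$ is the group of all $\sigma\in S_m$ with $I(\sigma w^{[m]})=I(w^{[m]})$ for all $w^{[m]}$; $G_X,G_Y$ are the invariance groups of $I_X,I_Y$. $Z^i=(X^i,Y^i)$, $i\ge1$, are i.i.d. copies of $(X,Y)\in\mathbb{R}^r\times\mathbb{R}^s$. With $$k(z^{[m]})=\Big(\sum_{\sigma\in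 H}\mathrm{sign}(\sigma)I_X(x^{\sigma[m]})\Big)\Big(\sum_{\sigma\in H}\mathrm{sign}(\sigma)I_Y(y^{\sigma[m]})\Big),\qquad\kappa(z^{[m]})=\frac1{m!}\sum_{\sigma\in S_m}k(z^{\sigma[m]}),$$ one has $\mu(X,Y)=E[k(Z^{[m]})]$, $\kappa_1(z^1)=E[\kappa(z^1,Z^2,\dots,Z^m)]$, and $U_\mu(z^{[n]})=\binom nm^{-1}\sum_{1\le i_1<\dots<i_m\le n}\kappa(z^{i_1},\dots,z^{i_m})$ for $n\ge m$. *)

theory Defs
  imports "HOL-Probability.Probability" "HOL-Algebra.Sym_Groups"
begin

text \<open>
  A tuple of \<open>m\<close> points \<open>w\<^sup>1, \<dots>, w\<^sup>m\<close> of a set \<open>A\<close> is represented by a function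
  \<open>w :: nat \<Rightarrow> A\<close>, of which only the values at the indices \<open>1, \<dots>, m\<close> matter. For rank
  indicator functions this is not an extra assumption: \<open>joint_rank m w\<close> is determined by the values
  of \<open>w\<close> on \<open>{1..m}\<close>, hence so is \<open>I w = I (joint_rank m w)\<close>. The group \<open>S\<^sub>m\<close> is
  \<open>sym_group m\<close>, whose elements fix every index outside \<open>{1..m}\<close>.
\<close>

definition permute_tuple :: "(nat \<Rightarrow> nat) \<Rightarrow> (nat \<Rightarrow> 'a) \<Rightarrow> (nat \<Rightarrow> 'a)" where
  "permute_tuple \<sigma> w = (\<lambda>i. w (inv' \<sigma> i))"

text \<open>The first index \<open>i\<close> of the rank matrix is the coordinate, the second one \<open>j\<close> the point.\<close>

definition joint_rank :: "nat \<Rightarrow> (nat \<Rightarrow> real ^ 'd) \<Rightarrow> (nat \<Rightarrow> real ^ 'd)" where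
  "joint_rank m w = (\<lambda>j\<in>{1..m}. \<chi> i. 1 + (\<Sum>k=1..m. of_bool (w k $ i < w j $ i)))"

definition rank_indicator :: "nat \<Rightarrow> ((nat \<Rightarrow> real ^ 'd) \<Rightarrow> real) \<Rightarrow> bool" where
  "rank_indicator m I \<longleftrightarrow> (\<forall>w. I w \<in> {0, 1}) \<and> (\<forall>w. I (joint_rank m w) = I w)"

definition invariance_group :: "nat \<Rightarrow> ((nat \<Rightarrow> 'a) \<Rightarrow> real) \<Rightarrow> (nat \<Rightarrow> nat) set" where
  "invariance_group m I =
     {\<sigma> \<in> carrier (sym_group m). \<forall>w. I (permute_tuple \<sigma> w) = I w}"

definition equally_many_even_odd :: "(nat \<Rightarrow> nat) set \<Rightarrow> bool" where
  "equally_many_even_odd C \<longleftrightarrow> card {h \<in> C. evenperm h} = card {h \<in> C. \<not> evenperm h}"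

definition src_kernel ::
  "((nat \<Rightarrow> 'a) \<Rightarrow> real) \<Rightarrow> ((nat \<Rightarrow> 'b) \<Rightarrow> real) \<Rightarrow> (nat \<Rightarrow> nat) set \<Rightarrow> (nat \<Rightarrow> 'a \<times> 'b) \<Rightarrow> real" where
  "src_kernel IX IY H z =
     (\<Sum>\<sigma>\<in>H. of_int (sign \<sigma>) * IX (permute_tuple \<sigma> (\<lambda>i. fst (z i)))) *
     (\<Sum>\<sigma>\<in>H. of_int (sign \<sigma>) * IY (permute_tuple \<sigma> (\<lambda>i. snd (z i))))"

text \<open>\<open>\<mu>\<close> is a functional of the law \<open>P\<close> of \<open>(X, Y)\<close>: under \<open>P\<^sup>m\<close> the points are i.i.d. copies.\<close>

definition is_symmetric_rank_covariance ::
  "nat \<Rightarrow> ((nat \<Rightarrow> real ^ 'r) \<Rightarrow> real) \<Rightarrow> ((nat \<Rightarrow> real ^ 's) \<Rightarrow> real) \<Rightarrow> (nat \<Rightarrow> nat) set \<Rightarrow>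
    (((real ^ 'r) \<times> (real ^ 's)) measure \<Rightarrow> real) \<Rightarrow> bool" where
  "is_symmetric_rank_covariance m IX IY H \<mu> \<longleftrightarrow>
     rank_indicator m IX \<and> rank_indicator m IY \<and>
     subgroup H (sym_group m) \<and> equally_many_even_odd H \<and>
     (\<forall>P. \<mu> P = (\<integral>z. src_kernel IX IY H z \<partial>(Pi\<^sub>M {1..m} (\<lambda>_. P))))"

definition src_kappa ::
  "nat \<Rightarrow> ((nat \<Rightarrow> 'a) \<Rightarrow> real) \<Rightarrow> ((nat \<Rightarrow> 'b) \<Rightarrow> real) \<Rightarrow> (nat \<Rightarrow> nat) set \<Rightarrow>
    (nat \<Rightarrow> 'a \<times> 'b) \<Rightarrow> real" where
  "src_kappa m IX IY H z =
     (\<Sum>\<sigma>\<in>carrier (sym_group m). src_kernel IX IY H (permute_tuple \<sigma> z)) / fact m"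

definition src_kappa1 ::
  "nat \<Rightarrow> ((nat \<Rightarrow> 'a) \<Rightarrow> real) \<Rightarrow> ((nat \<Rightarrow> 'b) \<Rightarrow> real) \<Rightarrow> (nat \<Rightarrow> nat) set \<Rightarrow>
    'o measure \<Rightarrow> (nat \<Rightarrow> 'o \<Rightarrow> 'a \<times> 'b) \<Rightarrow> 'a \<times> 'b \<Rightarrow> real" where
  "src_kappa1 m IX IY H M Z z1 =
     (\<integral>\<omega>. src_kappa m IX IY H ((\<lambda>i. Z i \<omega>)(1 := z1)) \<partial>M)"

definition src_U ::
  "nat \<Rightarrow> ((nat \<Rightarrow> 'a) \<Rightarrow> real) \<Rightarrow> ((nat \<Rightarrow> 'b) \<Rightarrow> real) \<Rightarrow> (nat \<Rightarrow> nat) set \<Rightarrow>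
    nat \<Rightarrow> (nat \<Rightarrow> 'a \<times> 'b) \<Rightarrow> real" where
  "src_U m IX IY H n z =
     (\<Sum>i\<in>{i \<in> {1..m} \<rightarrow>\<^sub>E {1..n}. strict_mono_on {1..m} i}. src_kappa m IX IY H (\<lambda>j. z (i j)))
       / real (n choose m)"

definition position_rel ::
  "(nat \<Rightarrow> nat) set \<Rightarrow> (nat \<Rightarrow> nat) set \<Rightarrow> nat \<Rightarrow> ((nat \<Rightarrow> nat) \<times> (nat \<Rightarrow> nat)) set" where
  "position_rel G H i = {(h, h'). h \<in> H \<and> h' \<in> H \<and> (\<exists>g\<in>G. g (h i) = h' i)}"

definition iid_copies ::
  "'o measure \<Rightarrow> (nat \<Rightarrow> 'o \<Rightarrow> 'a::topological_space) \<Rightarrow> ('o \<Rightarrow> 'a) \<Rightarrow> bool" where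
  "iid_copies M Z W \<longleftrightarrow>
     prob_space.indep_vars M (\<lambda>_. borel) Z {1..} \<and>
     (\<forall>i\<ge>1. distr M borel (Z i) = distr M borel W)"

text \<open>\<open>indep_var\<close> only covers random variables with values in the same type; as there, independence
  is that of the generated \<open>\<sigma>\<close>-algebras.\<close>

definition indep_rvs ::
  "'o measure \<Rightarrow> ('o \<Rightarrow> 'a::topological_space) \<Rightarrow> ('o \<Rightarrow> 'b::topological_space) \<Rightarrow> bool" where
  "indep_rvs M X Y \<longleftrightarrow>
     prob_space.indep_set M {X -` A \<inter> space M |A. A \<in> sets borel}
                            {Y -` B \<inter> space M |B. B \<in> sets borel}"

definition tendsto_zero_in_prob :: "'o measure \<Rightarrow> (nat \<Rightarrow> 'o \<Rightarrow> real) \<Rightarrow> bool" where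
  "tendsto_zero_in_prob M T \<longleftrightarrow>
     (\<forall>\<epsilon>>0. (\<lambda>n. measure M {\<omega> \<in> space M. \<bar>T n \<omega>\<bar> > \<epsilon>}) \<longlonglongrightarrow> 0)"

end

theory Submission
  imports Defs "HOL-Real_Asymp.Real_Asymp"
begin

text \<open>
  For a fixed point \<open>x\<close> placed at position \<open>p\<close> of an otherwise i.i.d. tuple, let \<open>\<Phi> p\<close> be the
  expected value of \<open>I\<^sub>X\<close>. Permuting the i.i.d. entries does not change their law, so \<open>\<Phi>\<close> is constant
  on the orbits of \<open>G\<close>, and applying \<open>h \<sigma>\<close> to a tuple with \<open>x\<close> at \<open>q\<close> gives expectation
  \<open>\<Phi> (h (\<sigma> q))\<close>. By the hypothesis on the classes the signed sum of these numbers over \<open>H\<close> cancels.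
  Under independence the integral of the kernel with one argument fixed is a product of two such
  signed sums, one for each of \<open>X\<close> and \<open>Y\<close>, so it vanishes, whichever argument is fixed.

  Hence \<open>\<kappa>(Z\<^sub>A)\<close> and \<open>\<kappa>(Z\<^sub>B)\<close> are uncorrelated with mean zero as soon as the \<open>m\<close>-sets \<open>A\<close> and \<open>B\<close>
  share at most one index. Only a fraction \<open>O(1/n\<^sup>2)\<close> of the pairs share two or more,
  so \<open>n E U\<^sup>2 = O(1/n)\<close> and Chebyshev's inequality applies.
\<close>

declare One_nat_def [simp del]

subsection \<open>Permuted tuples and rank indicators\<close>

text \<open>Points of \<open>Pi\<^sub>M\<close> are \<open>undefined\<close> outside the index set,
  whereas sample tuples such as \<open>\<lambda>i. Z i \<omega>\<close> are not. This predicate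
  allows passing between a tuple and its restriction.\<close>

definition determined_on :: "'i set \<Rightarrow> (('i \<Rightarrow> 'a) \<Rightarrow> 'b) \<Rightarrow> bool" where
  "determined_on S f \<longleftrightarrow> (\<forall>w w'. (\<forall>j\<in>S. w j = w' j) \<longrightarrow> f w = f w')"

lemma determined_onD: "determined_on S f \<Longrightarrow> (\<And>j. j \<in> S \<Longrightarrow> w j = w' j) \<Longrightarrow> f w = f w'"
  unfolding determined_on_def by blast

text \<open>The inverse in \<open>permute_tuple\<close> makes it a left action, since inverting
  reverses composition.\<close>

lemma permute_tuple_comp:
  "bij \<sigma> \<Longrightarrow> bij \<tau> \<Longrightarrow> permute_tuple \<sigma> (permute_tuple \<tau> w) = permute_tuple (\<sigma> \<circ> \<tau>) w"
  by (simp add: permute_tuple_def o_inv_distrib)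

text \<open>Position \<open>i\<close> of the permuted tuple reads entry
  \<open>inv' \<tau> i\<close>, which is \<open>q\<close> exactly for
  \<open>i = \<tau> q\<close>.\<close>

lemma permute_tuple_upd:
  "bij \<tau> \<Longrightarrow> permute_tuple \<tau> (w(q := a)) = (permute_tuple \<tau> w)(\<tau> q := a)"
  by (auto simp: permute_tuple_def fun_eq_iff bij_is_surj surj_f_inv_f bij_is_inj inv_f_f)

lemma determined_on_rank_indicator:
  fixes I :: "(nat \<Rightarrow> real ^ 'd) \<Rightarrow> real"
  assumes "rank_indicator m I"
  shows "determined_on {1..m} I"
  unfolding determined_on_def
proof (intro allI impI)
  fix w w' :: "nat \<Rightarrow> real ^ 'd" assume "\<forall>j\<in>{1..m}. w j = w' j"
  then have "joint_rank m w = joint_rank m w'"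
    unfolding joint_rank_def by (intro restrict_ext) (auto simp: vec_eq_iff)
  then show "I w = I w'"
    using assms unfolding rank_indicator_def by metis
qed

lemma rank_indicator_bound: "rank_indicator m I \<Longrightarrow> \<bar>I w\<bar> \<le> 1"
  unfolding rank_indicator_def by (metis abs_0 abs_1 insertE order_refl singletonD zero_le_one)

text \<open>Measurability holds because the joint ranks are a function of the finite set of strict
  inequalities between coordinates.\<close>

lemma measurable_rank_indicator:
  fixes I :: "(nat \<Rightarrow> real ^ 'd) \<Rightarrow> real"
  assumes I: "rank_indicator m I"
    and f: "\<And>k. k \<in> {1..m} \<Longrightarrow> (\<lambda>\<omega>. f \<omega> k) \<in> borel_measurable N"
  shows "(\<lambda>\<omega>. I (f \<omega>)) \<in> borel_measurable N"
proof -
  \<comment> \<open>A triple \<open>(k, j, i)\<close> encodes the comparison of points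
    \<open>k\<close> and \<open>j\<close> in coordinate \<open>i\<close>. The set
    \<open>c \<omega>\<close> records which comparisons are strict, and \<open>r\<close> rebuilds
    the rank matrix from it before applying \<open>I\<close>.\<close>
  define S where "S = {1..m} \<times> {1..m} \<times> (UNIV :: 'd set)"
  define c where "c \<omega> = {t \<in> S. f \<omega> (fst t) $ snd (snd t) < f \<omega> (fst (snd t)) $ snd (snd t)}" for \<omega>
  define r where
    "r P = I (\<lambda>j\<in>{1..m}. \<chi> i. 1 + (\<Sum>k=1..m. of_bool ((k, j, i) \<in> P)))" for P
  have "finite S" by (simp add: S_def)
  have comp: "(\<lambda>\<omega>. f \<omega> k $ i) \<in> borel_measurable N" if "k \<in> {1..m}" for k i
    using f[OF that] by (rule measurable_compose) (simp add: borel_measurable_continuous_onI continuous_on_component)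
  \<comment> \<open>The target is finite, so only preimages of single comparison patterns have to be
    measurable; \<open>r\<close> can then be any function on the discrete space.\<close>
  have "c \<in> measurable N (count_space (Pow S))"
    unfolding measurable_count_space_eq2[OF finite_Pow_iff[THEN iffD2, OF \<open>finite S\<close>]]
  proof (intro conjI ballI)
    show "c \<in> space N \<rightarrow> Pow S" by (auto simp: c_def)
    fix P assume "P \<in> Pow S"
    then have "c -` {P} \<inter> space N =
        {\<omega> \<in> space N. \<forall>t\<in>S. (f \<omega> (fst t) $ snd (snd t) < f \<omega> (fst (snd t)) $ snd (snd t)) = (t \<in> P)}"
      unfolding c_def by blast
    also have "\<dots> \<in> sets N"
    proof (rule sets.sets_Collect_finite_All[OF _ \<open>finite S\<close>])
      fix t assume "t \<in> S"
      then have [measurable]: "(\<lambda>\<omega>. f \<omega> (fst t) $ snd (snd t)) \<in> borel_measurable N"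
        "(\<lambda>\<omega>. f \<omega> (fst (snd t)) $ snd (snd t)) \<in> borel_measurable N"
        by (auto simp: S_def intro: comp)
      show "{\<omega> \<in> space N. (f \<omega> (fst t) $ snd (snd t) < f \<omega> (fst (snd t)) $ snd (snd t)) = (t \<in> P)}
          \<in> sets N"
        by measurable
    qed
    finally show "c -` {P} \<inter> space N \<in> sets N" .
  qed
  then have "(\<lambda>\<omega>. r (c \<omega>)) \<in> borel_measurable N"
    by (rule measurable_compose) simp
  also have "(\<lambda>\<omega>. r (c \<omega>)) = (\<lambda>\<omega>. I (f \<omega>))"
  proof
    fix \<omega>
    have "(\<lambda>j\<in>{1..m}. \<chi> i. 1 + (\<Sum>k=1..m. of_bool ((k, j, i) \<in> c \<omega>))) = joint_rank m (f \<omega>)"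
      unfolding joint_rank_def
      by (intro restrict_ext) (auto simp: vec_eq_iff c_def S_def intro!: sum.cong)
    then show "r (c \<omega>) = I (f \<omega>)"
      using I by (simp add: r_def rank_indicator_def)
  qed
  finally show ?thesis .
qed

text \<open>\<open>F\<close> is constant on each class, so a class contributes that constant times
  the difference of its numbers of even and odd elements, which is zero.\<close>

lemma sum_sign_eq_0:
  fixes F :: "(nat \<Rightarrow> nat) \<Rightarrow> real"
  assumes "finite H" "equiv H R"
    and classes: "\<And>C. C \<in> H // R \<Longrightarrow> equally_many_even_odd C"
    and F: "\<And>h h'. (h, h') \<in> R \<Longrightarrow> F h = F h'"
  shows "(\<Sum>h\<in>H. of_int (sign h) * F h) = 0"
proof -
  have fin: "finite C" if "C \<in> H // R" for C
    using that assms(1,2) by (meson equiv_def finite_equiv_class equiv_type)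
  have "sum (\<lambda>h. of_int (sign h) * F h) (\<Union>(H // R)) =
      (\<Sum>C\<in>H // R. \<Sum>h\<in>C. of_int (sign h) * F h)"
    using fin quotient_disj[OF \<open>equiv H R\<close>]
    by (subst sum.Union_disjoint) (blast, blast, simp)
  then have "(\<Sum>h\<in>H. of_int (sign h) * F h) = (\<Sum>C\<in>H // R. \<Sum>h\<in>C. of_int (sign h) * F h)"
    by (simp add: Union_quotient[OF \<open>equiv H R\<close>])
  also have "\<dots> = 0"
  proof (rule sum.neutral, rule ballI)
    fix C assume C: "C \<in> H // R"
    then obtain h0 where h0: "C = R `` {h0}" by (auto elim: quotientE)
    have "(\<Sum>h\<in>C. of_int (sign h) * F h) = (\<Sum>h\<in>C. of_int (sign h)) * F h0"
      unfolding sum_distrib_right using F h0 by (intro sum.cong) auto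
    also have "(\<Sum>h\<in>C. of_int (sign h) :: real) =
        (\<Sum>h\<in>C. of_bool (evenperm h) - of_bool (\<not> evenperm h))"
      by (intro sum.cong) (auto simp: sign_def)
    also have "\<dots> = real (card {h \<in> C. evenperm h}) - real (card {h \<in> C. \<not> evenperm h})"
      using fin[OF C] by (simp add: sum_subtractf sum_of_bool_eq Int_def)
    finally show "(\<Sum>h\<in>C. of_int (sign h) * F h) = 0"
      using classes[OF C] by (simp add: equally_many_even_odd_def)
  qed
  finally show ?thesis .
qed

section \<open>Invariance groups and the classes they induce on \<open>H\<close>\<close>

lemma invariance_group_iff:
  "\<sigma> \<in> invariance_group m I \<longleftrightarrow> \<sigma> permutes {1..m} \<and> (\<forall>w. I (permute_tuple \<sigma> w) = I w)"
  by (simp add: invariance_group_def sym_group_carrier)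

lemma id_in_invariance_group: "id \<in> invariance_group m I"
  by (simp add: invariance_group_iff permutes_id permute_tuple_def)

lemma comp_in_invariance_group:
  "\<sigma> \<in> invariance_group m I \<Longrightarrow> \<tau> \<in> invariance_group m I \<Longrightarrow> \<sigma> \<circ> \<tau> \<in> invariance_group m I"
  unfolding invariance_group_iff using permutes_compose permutes_bij permute_tuple_comp by metis

lemma inv_in_invariance_group:
  assumes "\<sigma> \<in> invariance_group m I"
  shows "inv' \<sigma> \<in> invariance_group m I"
proof -
  have \<sigma>: "\<sigma> permutes {1..m}" "\<And>w. I (permute_tuple \<sigma> w) = I w"
    using assms by (auto simp: invariance_group_iff)
  have "I (permute_tuple (inv' \<sigma>) w) = I w" for w
  proof -
    have "I (permute_tuple (inv' \<sigma>) w) = I (permute_tuple \<sigma> (permute_tuple (inv' \<sigma>) w))"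
      by (simp add: \<sigma>)
    also have "permute_tuple \<sigma> (permute_tuple (inv' \<sigma>) w) = w"
      using \<sigma>(1) by (simp add: permute_tuple_def permutes_inv_inv permutes_inverses)
    finally show ?thesis .
  qed
  then show ?thesis
    using \<sigma>(1) by (simp add: invariance_group_iff permutes_inv)
qed

text \<open>\<open>h\<close> and \<open>h'\<close> are related when \<open>h i\<close> and
  \<open>h' i\<close> lie in one orbit of \<open>G\<close>. Identity, inverses and composition in
  \<open>G\<close> give the three properties.\<close>

lemma equiv_position_rel:
  assumes G: "G = invariance_group m I \<inter> invariance_group m J"
  shows "equiv H (position_rel G H i)"
proof (rule equivI)
  show "position_rel G H i \<subseteq> H \<times> H" by (auto simp: position_rel_def)
  show "refl_on H (position_rel G H i)"
    using id_in_invariance_group[of m I] id_in_invariance_group[of m J]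
    unfolding G refl_on_def position_rel_def mem_Collect_eq prod.case Bex_def Int_iff
    by (metis id_apply)
  show "sym (position_rel G H i)"
  proof (rule symI)
    fix h h' assume "(h, h') \<in> position_rel G H i"
    then obtain g where g: "h \<in> H" "h' \<in> H" "g \<in> G" "g (h i) = h' i"
      by (auto simp: position_rel_def)
    then have "bij g" by (auto simp: G invariance_group_iff permutes_bij)
    then have "inv' g (h' i) = h i"
      using g(4) by (metis bij_inv_eq_iff)
    moreover have "inv' g \<in> G" using g(3) by (simp add: G inv_in_invariance_group)
    ultimately show "(h', h) \<in> position_rel G H i"
      using g by (auto simp: position_rel_def)
  qed
  show "trans (position_rel G H i)"
  proof (rule transI)
    fix h1 h2 h3 assume "(h1, h2) \<in> position_rel G H i" "(h2, h3) \<in> position_rel G H i"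
    then obtain g g' where g: "h1 \<in> H" "h3 \<in> H" "g \<in> G" "g' \<in> G" "g (h1 i) = h2 i" "g' (h2 i) = h3 i"
      by (auto simp: position_rel_def)
    then have "g' \<circ> g \<in> G" "(g' \<circ> g) (h1 i) = h3 i"
      by (auto simp: G comp_in_invariance_group)
    then show "(h1, h3) \<in> position_rel G H i"
      using g(1,2) unfolding position_rel_def by blast
  qed
qed

text \<open>For \<open>m \<le> 1\<close> the group \<open>H\<close> is trivial, with one even and no
  odd element. The bound supplies a position \<open>1\<close> and makes \<open>m - 2\<close> a
  genuine difference in the counting.\<close>

lemma two_le_order:
  assumes H: "subgroup H (sym_group m)" and eo: "equally_many_even_odd H"
  shows "2 \<le> m"
proof (rule ccontr)
  assume "\<not> 2 \<le> m"
  have "h = id" if "h \<in> H" for h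
  proof -
    have "h permutes {1..m}" using that subgroup.subset[OF H] by (auto simp: sym_group_carrier)
    then have "h permutes {1}" using \<open>\<not> 2 \<le> m\<close> by (elim permutes_subset) auto
    then show ?thesis by simp
  qed
  moreover have "id \<in> H"
    using subgroup.one_closed[OF H] by (simp add: sym_group_one)
  ultimately have "H = {id}" by auto
  then have "{h \<in> H. evenperm h} = {id}" and odd: "{h \<in> H. \<not> evenperm h} = {}"
    by auto
  then show False
    using eo unfolding equally_many_even_odd_def odd by simp
qed

section \<open>Permuting and pairing coordinates under product measures\<close>

lemma integral_permute_upd:
  fixes f :: "(nat \<Rightarrow> 'a) \<Rightarrow> real"
  assumes D: "prob_space D" and \<tau>: "\<tau> permutes {1..m}"
    and f: "determined_on {1..m} f"
    and meas: "(\<lambda>w. f (w(\<tau> q := a))) \<in> borel_measurable (Pi\<^sub>M {1..m} (\<lambda>_. D))"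
  shows "(\<integral>w. f (permute_tuple \<tau> (w(q := a))) \<partial>Pi\<^sub>M {1..m} (\<lambda>_. D)) =
    (\<integral>w. f (w(\<tau> q := a)) \<partial>Pi\<^sub>M {1..m} (\<lambda>_. D))"
proof -
  have inv: "inv' \<tau> permutes {1..m}" using \<tau> by (rule permutes_inv)
  \<comment> \<open>Reading coordinate \<open>inv' \<tau> n\<close> in place of \<open>n\<close>
    leaves the i.i.d. law unchanged, so the integral may be computed on the relabelled
    tuple.\<close>
  have "(\<integral>w. f (w(\<tau> q := a)) \<partial>Pi\<^sub>M {1..m} (\<lambda>_. D)) =
      (\<integral>w. f (w(\<tau> q := a)) \<partial>distr (Pi\<^sub>M {1..m} (\<lambda>_. D)) (Pi\<^sub>M {1..m} (\<lambda>_. D))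
        (\<lambda>w. \<lambda>n\<in>{1..m}. w (inv' \<tau> n)))"
    by (subst distr_PiM_reindex[where f = "inv' \<tau>" and M = "\<lambda>_. D" and I = "{1..m}" and K = "{1..m}"])
       (use D permutes_inj_on[OF inv] permutes_in_image[OF inv] in auto)
  also have "\<dots> = (\<integral>w. f ((\<lambda>n\<in>{1..m}. w (inv' \<tau> n))(\<tau> q := a)) \<partial>Pi\<^sub>M {1..m} (\<lambda>_. D))"
    by (rule integral_distr[OF _ meas])
       (auto intro!: measurable_restrict measurable_component_singleton
          simp: permutes_in_image[OF inv, simplified])
  \<comment> \<open>The two arguments need not agree off \<open>{1..m}\<close>, where the
    restriction is \<open>undefined\<close>; \<open>determined_on\<close> makes agreement on
    \<open>{1..m}\<close> enough.\<close>
  also have "\<dots> = (\<integral>w. f (permute_tuple \<tau> (w(q := a))) \<partial>Pi\<^sub>M {1..m} (\<lambda>_. D))"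
    unfolding permute_tuple_upd[OF permutes_bij[OF \<tau>]]
    by (intro Bochner_Integration.integral_cong refl determined_onD[OF f]) (auto simp: permute_tuple_def)
  finally show ?thesis ..
qed

text \<open>Allows an integral over i.i.d. pairs to be split into its first and second components. A
  product measure is determined by its values on boxes, and these are computed by Tonelli.\<close>

lemma distr_PiM_pair:
  assumes "finite I" and D: "prob_space D" "prob_space E"
  shows "distr (Pi\<^sub>M I (\<lambda>_. D) \<Otimes>\<^sub>M Pi\<^sub>M I (\<lambda>_. E)) (Pi\<^sub>M I (\<lambda>_. D \<Otimes>\<^sub>M E)) (\<lambda>(x, y). \<lambda>i\<in>I. (x i, y i)) =
    Pi\<^sub>M I (\<lambda>_. D \<Otimes>\<^sub>M E)"
proof -
  interpret D: prob_space D by fact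
  interpret E: prob_space E by fact
  interpret DE: pair_prob_space D E ..
  interpret PD: product_sigma_finite "\<lambda>_ :: 'a. D" ..
  interpret PE: product_sigma_finite "\<lambda>_ :: 'a. E" ..
  interpret PDE: product_sigma_finite "\<lambda>_ :: 'a. D \<Otimes>\<^sub>M E" ..
  interpret ID: prob_space "Pi\<^sub>M I (\<lambda>_. D)" by (intro prob_space_PiM D)
  interpret IE: prob_space "Pi\<^sub>M I (\<lambda>_. E)" by (intro prob_space_PiM D)
  have zip[measurable]: "(\<lambda>(x, y). \<lambda>i\<in>I. (x i, y i)) \<in>
      measurable (Pi\<^sub>M I (\<lambda>_. D) \<Otimes>\<^sub>M Pi\<^sub>M I (\<lambda>_. E)) (Pi\<^sub>M I (\<lambda>_. D \<Otimes>\<^sub>M E))"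
    unfolding case_prod_beta by measurable
  show ?thesis
  proof (rule PDE.PiM_eqI[OF \<open>finite I\<close>])
    fix A assume A[measurable]: "\<And>i. i \<in> I \<Longrightarrow> A i \<in> sets (D \<Otimes>\<^sub>M E)"
    have "emeasure (distr (Pi\<^sub>M I (\<lambda>_. D) \<Otimes>\<^sub>M Pi\<^sub>M I (\<lambda>_. E)) (Pi\<^sub>M I (\<lambda>_. D \<Otimes>\<^sub>M E))
          (\<lambda>(x, y). \<lambda>i\<in>I. (x i, y i))) (Pi\<^sub>E I A) =
        (\<integral>\<^sup>+z. indicator (Pi\<^sub>E I A) z \<partial>distr (Pi\<^sub>M I (\<lambda>_. D) \<Otimes>\<^sub>M Pi\<^sub>M I (\<lambda>_. E)) (Pi\<^sub>M I (\<lambda>_. D \<Otimes>\<^sub>M E))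
          (\<lambda>(x, y). \<lambda>i\<in>I. (x i, y i)))"
      using \<open>finite I\<close> A by (intro nn_integral_indicator[symmetric]) (auto intro!: sets_PiM_I_finite)
    also have "\<dots> = (\<integral>\<^sup>+z. indicator (Pi\<^sub>E I A) (\<lambda>i\<in>I. (fst z i, snd z i))
        \<partial>(Pi\<^sub>M I (\<lambda>_. D) \<Otimes>\<^sub>M Pi\<^sub>M I (\<lambda>_. E)))"
      using \<open>finite I\<close> A
      by (subst nn_integral_distr)
         (auto simp: case_prod_beta intro!: sets_PiM_I_finite borel_measurable_indicator)
    also have "\<dots> = (\<integral>\<^sup>+z. (\<Prod>i\<in>I. indicator (A i) (fst z i, snd z i))
        \<partial>(Pi\<^sub>M I (\<lambda>_. D) \<Otimes>\<^sub>M Pi\<^sub>M I (\<lambda>_. E)))"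
      using \<open>finite I\<close> 
      by (intro nn_integral_cong) (auto simp: indicator_def PiE_iff prod_zero_iff)
    \<comment> \<open>The sets \<open>A i\<close> are arbitrary measurable sets of pairs, not
      rectangles, so the product is pulled out of the integral over \<open>y\<close> with
      \<open>x\<close> fixed, and then out of the integral over \<open>x\<close>.\<close>
    also have "\<dots> = (\<integral>\<^sup>+x. \<integral>\<^sup>+y. (\<Prod>i\<in>I. indicator (A i) (x i, y i)) \<partial>Pi\<^sub>M I (\<lambda>_. E) \<partial>Pi\<^sub>M I (\<lambda>_. D))"
      by (subst IE.nn_integral_fst[symmetric]) auto
    also have "\<dots> = (\<integral>\<^sup>+x. (\<Prod>i\<in>I. \<integral>\<^sup>+y. indicator (A i) (x i, y) \<partial>E) \<partial>Pi\<^sub>M I (\<lambda>_. D))"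
    proof (intro nn_integral_cong PE.product_nn_integral_prod[OF \<open>finite I\<close>])
      fix x i assume "x \<in> space (Pi\<^sub>M I (\<lambda>_. D))" "i \<in> I"
      then have [measurable]: "x i \<in> space D" by (auto simp: space_PiM PiE_iff)
      note A[OF \<open>i \<in> I\<close>, measurable]
      show "(\<lambda>y. indicator (A i) (x i, y)) \<in> borel_measurable E" by measurable
    qed
    also have "\<dots> = (\<Prod>i\<in>I. \<integral>\<^sup>+x. \<integral>\<^sup>+y. indicator (A i) (x, y) \<partial>E \<partial>D)"
    proof (intro PD.product_nn_integral_prod[OF \<open>finite I\<close>])
      fix i assume "i \<in> I"
      note A[OF this, measurable]
      show "(\<lambda>x. \<integral>\<^sup>+y. indicator (A i) (x, y) \<partial>E) \<in> borel_measurable D" by measurable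
    qed
    also have "\<dots> = (\<Prod>i\<in>I. emeasure (D \<Otimes>\<^sub>M E) (A i))"
      using A by (intro prod.cong refl E.emeasure_pair_measure[symmetric]) auto
    finally show "emeasure (distr (Pi\<^sub>M I (\<lambda>_. D) \<Otimes>\<^sub>M Pi\<^sub>M I (\<lambda>_. E)) (Pi\<^sub>M I (\<lambda>_. D \<Otimes>\<^sub>M E))
          (\<lambda>(x, y). \<lambda>i\<in>I. (x i, y i))) (Pi\<^sub>E I A) = (\<Prod>i\<in>I. emeasure (D \<Otimes>\<^sub>M E) (A i))" .
  qed simp
qed

subsection \<open>Degenerate U-statistics\<close>

definition increasing_tuples :: "nat \<Rightarrow> nat \<Rightarrow> (nat \<Rightarrow> nat) set" where
  "increasing_tuples m n = {i \<in> {1..m} \<rightarrow>\<^sub>E {1..n}. strict_mono_on {1..m} i}"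

lemma finite_increasing_tuples: "finite (increasing_tuples m n)"
  unfolding increasing_tuples_def by (rule finite_subset[OF _ finite_PiE[of "{1..m}" "\<lambda>_. {1..n}"]]) auto

lemma increasing_tuplesD:
  assumes "i \<in> increasing_tuples m n"
  shows "i \<in> {1..m} \<rightarrow> {1..n}" "inj_on i {1..m}" "card (i ` {1..m}) = m"
proof -
  show "i \<in> {1..m} \<rightarrow> {1..n}" using assms by (auto simp: increasing_tuples_def PiE_iff)
  show "inj_on i {1..m}"
    using assms unfolding increasing_tuples_def by (auto intro: strict_mono_on_imp_inj_on)
  then show "card (i ` {1..m}) = m" by (simp add: card_image)
qed

text \<open>A finite set has only one strictly sorted enumeration, and
  \<open>\<rightarrow>\<^sub>E\<close> fixes the values outside \<open>{1..m}\<close>. Tuples can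
  thus be counted as subsets of \<open>{1..n}\<close>.\<close>

lemma inj_on_image_increasing_tuples: "inj_on (\<lambda>i. i ` {1..m}) (increasing_tuples m n)"
proof (rule inj_onI)
  fix i i' assume i: "i \<in> increasing_tuples m n" "i' \<in> increasing_tuples m n"
    and eq: "i ` {1..m} = i' ` {1..m}"
  have sorted: "sorted_wrt (<) (map j [1..<Suc m])" if "j \<in> increasing_tuples m n" for j
    using that unfolding increasing_tuples_def
    by (auto simp: sorted_wrt_map strict_mono_on_def simp del: upt_Suc
        intro!: sorted_wrt_mono_rel[OF _ sorted_wrt_upt])
  have "map i [1..<Suc m] = map i' [1..<Suc m]"
    using sorted[OF i(1)] sorted[OF i(2)] eq
    by (intro strict_sorted_equal) (auto simp: atLeastLessThanSuc_atLeastAtMost simp del: upt_Suc)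
  then have "i j = i' j" if "j \<in> {1..m}" for j
    using that by (auto simp del: upt_Suc)
  then show "i = i'"
    using i unfolding increasing_tuples_def by (intro PiE_ext[of i "{1..m}" "\<lambda>_. {1..n}"]) auto
qed

text \<open>Removing \<open>T\<close> from the image leaves an \<open>m - 2\<close>-element subset
  of \<open>{1..n} - T\<close>, and the tuple can be recovered from it.\<close>

lemma card_increasing_tuples_supset:
  assumes "2 \<le> m" "T \<subseteq> {1..n}" "card T = 2"
  shows "card {i \<in> increasing_tuples m n. T \<subseteq> i ` {1..m}} \<le> (n - 2) choose (m - 2)"
proof -
  have "finite T" using assms(2) finite_subset by blast
  have "inj_on (\<lambda>i. i ` {1..m} - T) {i \<in> increasing_tuples m n. T \<subseteq> i ` {1..m}}"
  proof (rule inj_onI)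
    fix i i' assume i: "i \<in> {i \<in> increasing_tuples m n. T \<subseteq> i ` {1..m}}"
      "i' \<in> {i \<in> increasing_tuples m n. T \<subseteq> i ` {1..m}}"
      and "i ` {1..m} - T = i' ` {1..m} - T"
    then have "i ` {1..m} = i' ` {1..m}" by blast
    then show "i = i'" using i inj_onD[OF inj_on_image_increasing_tuples] by blast
  qed
  moreover have "(\<lambda>i. i ` {1..m} - T) ` {i \<in> increasing_tuples m n. T \<subseteq> i ` {1..m}} \<subseteq>
      {B. B \<subseteq> {1..n} - T \<and> card B = m - 2}"
  proof (intro image_subsetI CollectI conjI)
    fix i assume "i \<in> {i \<in> increasing_tuples m n. T \<subseteq> i ` {1..m}}"
    then have i: "i \<in> increasing_tuples m n" "T \<subseteq> i ` {1..m}" by auto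
    show "i ` {1..m} - T \<subseteq> {1..n} - T" using increasing_tuplesD(1)[OF i(1)] by blast
    show "card (i ` {1..m} - T) = m - 2"
      using increasing_tuplesD(3)[OF i(1)] i(2) assms(3) \<open>finite T\<close> by (simp add: card_Diff_subset)
  qed
  ultimately have "card {i \<in> increasing_tuples m n. T \<subseteq> i ` {1..m}} \<le>
      card {B. B \<subseteq> {1..n} - T \<and> card B = m - 2}"
    by (rule card_inj_on_le) simp
  also have "\<dots> = (n - 2) choose (m - 2)"
    using assms \<open>finite T\<close> by (simp add: n_subsets card_Diff_subset)
  finally show ?thesis .
qed

text \<open>Union bound over a two-element set \<open>T\<close> contained in both images. Pairs with
  larger overlap are counted several times, hence only an inequality.\<close>

lemma card_overlapping_tuples:
  assumes "2 \<le> m"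
  shows "card {(i, j) \<in> increasing_tuples m n \<times> increasing_tuples m n.
      2 \<le> card (i ` {1..m} \<inter> j ` {1..m})} \<le> (n choose 2) * ((n - 2) choose (m - 2))\<^sup>2"
proof -
  let ?S = "\<lambda>T. {i \<in> increasing_tuples m n. T \<subseteq> i ` {1..m}}"
  let ?T = "{T. T \<subseteq> {1..n} \<and> card T = 2}"
  have "finite ?T" by simp
  have fin: "finite (?S T)" for T using finite_increasing_tuples by simp
  have "{(i, j) \<in> increasing_tuples m n \<times> increasing_tuples m n.
      2 \<le> card (i ` {1..m} \<inter> j ` {1..m})} \<subseteq> (\<Union>T\<in>?T. ?S T \<times> ?S T)"
  proof (clarify)
    fix i j assume ij: "i \<in> increasing_tuples m n" "j \<in> increasing_tuples m n"
      and "2 \<le> card (i ` {1..m} \<inter> j ` {1..m})"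
    then obtain T where "T \<subseteq> i ` {1..m} \<inter> j ` {1..m}" "card T = 2"
      by (meson obtain_subset_with_card_n)
    moreover have "T \<subseteq> {1..n}" using calculation(1) increasing_tuplesD(1)[OF ij(1)] by blast
    ultimately show "(i, j) \<in> (\<Union>T\<in>?T. ?S T \<times> ?S T)" using ij by blast
  qed
  then have "card {(i, j) \<in> increasing_tuples m n \<times> increasing_tuples m n.
      2 \<le> card (i ` {1..m} \<inter> j ` {1..m})} \<le> card (\<Union>T\<in>?T. ?S T \<times> ?S T)"
    by (rule card_mono[rotated]) (use \<open>finite ?T\<close> fin in blast)
  also have "\<dots> \<le> (\<Sum>T\<in>?T. card (?S T \<times> ?S T))"
    by (rule card_UN_le[OF \<open>finite ?T\<close>])
  also have "\<dots> \<le> (\<Sum>T\<in>?T. ((n - 2) choose (m - 2))\<^sup>2)"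
    using card_increasing_tuples_supset[OF assms]
    by (intro sum_mono) (auto simp: card_cartesian_product power2_eq_square intro!: mult_le_mono)
  also have "\<dots> = (n choose 2) * ((n - 2) choose (m - 2))\<^sup>2"
    by (simp add: n_subsets)
  finally show ?thesis .
qed

text \<open>Counting an \<open>m\<close>-set together with a pair inside it in two ways gives
  \<open>(n choose m) * (m choose 2) = (n choose 2) * ((n - 2) choose (m - 2))\<close>; what remains
  is of order \<open>1/n\<close>.\<close>

lemma overlap_ratio_bound:
  assumes "2 \<le> m" "m \<le> n"
  shows "real n * real ((n choose 2) * ((n - 2) choose (m - 2))\<^sup>2) / (real (n choose m))\<^sup>2 =
    2 * (real (m choose 2))\<^sup>2 / (real n - 1)"
proof -
  have "(n choose m) * (m choose 2) = (n choose 2) * ((n - 2) choose (m - 2))"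
    using choose_mult[of 2 m n] assms by simp
  then have eq: "real (n choose m) * real (m choose 2) = real (n choose 2) * real ((n - 2) choose (m - 2))"
    by (metis of_nat_mult)
  have c2: "real (n choose 2) = real n * (real n - 1) / 2"
    using assms by (simp add: choose_two real_of_nat_div of_nat_diff)
  have pos: "real (n choose m) > 0" "real n - 1 > 0" "real n > 0" using assms by auto
  then have c2pos: "real (n choose 2) > 0" by (simp add: c2)
  \<comment> \<open>Multiplying and dividing by \<open>n choose 2\<close> completes the square, to
    which the identity \<open>eq\<close> applies.\<close>
  have "real n * real ((n choose 2) * ((n - 2) choose (m - 2))\<^sup>2) =
      real n * (real (n choose 2) * real ((n - 2) choose (m - 2)))\<^sup>2 / real (n choose 2)"
    using c2pos by (simp add: power2_eq_square)
  also have "\<dots> / (real (n choose m))\<^sup>2 = real n * (real (m choose 2))\<^sup>2 / real (n choose 2)"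
    unfolding eq[symmetric] power_mult_distrib using pos by simp
  also have "\<dots> = 2 * (real (m choose 2))\<^sup>2 / (real n - 1)"
    unfolding c2 using pos by simp
  finally show ?thesis .
qed

text \<open>The variance argument is isolated from ranks: \<open>k\<close> is any bounded kernel
  whose mean vanishes when one argument is held fixed. Quantifying over every position
  \<open>q\<close> takes the place of symmetry of \<open>k\<close>.\<close>

locale degenerate_kernel = prob_space D for D :: "'b measure" +
  fixes m :: nat and k :: "(nat \<Rightarrow> 'b) \<Rightarrow> real" and B :: real
  assumes order: "2 \<le> m"
    and kernel_determined: "determined_on {1..m} k"
    and kernel_measurable [measurable]: "k \<in> borel_measurable (Pi\<^sub>M {1..m} (\<lambda>_. D))"
    and kernel_bound: "\<And>w. \<bar>k w\<bar> \<le> B"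
    and degenerate: "\<And>q a. q \<in> {1..m} \<Longrightarrow> a \<in> space D \<Longrightarrow>
      (\<integral>w. k (w(q := a)) \<partial>Pi\<^sub>M {1..m} (\<lambda>_. D)) = 0"
begin

lemma measurable_kernel_comp:
  assumes "i \<in> {1..m} \<rightarrow> J"
  shows "(\<lambda>w. k (\<lambda>j. w (i j))) \<in> borel_measurable (Pi\<^sub>M J (\<lambda>_. D))"
proof -
  have "(\<lambda>w. k (\<lambda>j\<in>{1..m}. w (i j))) \<in> borel_measurable (Pi\<^sub>M J (\<lambda>_. D))"
    using assms by (intro measurable_compose[OF _ kernel_measurable] measurable_restrict
        measurable_component_singleton) auto
  also have "(\<lambda>w. k (\<lambda>j\<in>{1..m}. w (i j))) = (\<lambda>w. k (\<lambda>j. w (i j)))"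
    by (intro ext determined_onD[OF kernel_determined]) simp
  finally show ?thesis .
qed

text \<open>Carries \<open>degenerate\<close> from the positions \<open>{1..m}\<close> over to the
  sample indices chosen by \<open>i\<close>.\<close>

lemma integral_kernel_fixed_point:
  assumes "inj_on i {1..m}" "q \<in> {1..m}" "a \<in> space D"
  shows "(\<integral>y. k (\<lambda>j. if j = q then a else y (i j)) \<partial>Pi\<^sub>M (i ` ({1..m} - {q})) (\<lambda>_. D)) = 0"
proof -
  let ?L = "i ` ({1..m} - {q})" and ?f = "the_inv_into {1..m} i"
  have f: "?f (i j) = j" if "j \<in> {1..m}" for j
    using the_inv_into_f_f[OF assms(1) that] .
  have inj: "inj_on ?f ?L" using f by (auto simp: inj_on_def)
  have maps: "?f \<in> ?L \<rightarrow> {1..m}" using f by auto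
  have meas: "(\<lambda>y. k (\<lambda>j. if j = q then a else y (i j))) \<in> borel_measurable (Pi\<^sub>M ?L (\<lambda>_. D))"
  proof -
    have "(\<lambda>y. k (\<lambda>j\<in>{1..m}. if j = q then a else y (i j))) \<in> borel_measurable (Pi\<^sub>M ?L (\<lambda>_. D))"
    proof (intro measurable_compose[OF _ kernel_measurable] measurable_restrict)
      fix j assume "j \<in> {1..m}"
      then show "(\<lambda>y. if j = q then a else y (i j)) \<in> measurable (Pi\<^sub>M ?L (\<lambda>_. D)) D"
        using assms(3) by (cases "j = q") (auto intro!: measurable_component_singleton)
    qed
    also have "(\<lambda>y. k (\<lambda>j\<in>{1..m}. if j = q then a else y (i j))) =
        (\<lambda>y. k (\<lambda>j. if j = q then a else y (i j)))"
      by (intro ext determined_onD[OF kernel_determined]) simp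
    finally show ?thesis .
  qed
  \<comment> \<open>Reindexing by the inverse of \<open>i\<close> realises the law on
    \<open>?L\<close> as an image of the law on \<open>{1..m}\<close>. Coordinate \<open>q\<close>
    is dropped there, matching its being overwritten in \<open>degenerate\<close>.\<close>
  have "(\<integral>y. k (\<lambda>j. if j = q then a else y (i j)) \<partial>Pi\<^sub>M ?L (\<lambda>_. D)) =
      (\<integral>y. k (\<lambda>j. if j = q then a else y (i j))
        \<partial>distr (Pi\<^sub>M {1..m} (\<lambda>_. D)) (Pi\<^sub>M ?L (\<lambda>_. D)) (\<lambda>w. \<lambda>n\<in>?L. w (?f n)))"
    by (subst distr_PiM_reindex[where M = "\<lambda>_. D", OF prob_space_axioms inj maps]) simp
  also have "\<dots> = (\<integral>w. k (\<lambda>j. if j = q then a else (\<lambda>n\<in>?L. w (?f n)) (i j)) \<partial>Pi\<^sub>M {1..m} (\<lambda>_. D))"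
    by (rule integral_distr[OF _ meas])
       (use maps in \<open>auto intro!: measurable_restrict measurable_component_singleton\<close>)
  also have "\<dots> = (\<integral>w. k (w(q := a)) \<partial>Pi\<^sub>M {1..m} (\<lambda>_. D))"
    by (intro Bochner_Integration.integral_cong refl determined_onD[OF kernel_determined])
       (auto simp: f)
  finally show ?thesis using degenerate assms by simp
qed

lemma integral_times_kernel_eq_0:
  fixes \<Psi> :: "('i \<Rightarrow> 'b) \<Rightarrow> real"
  assumes "finite J" and i: "inj_on i {1..m}" "i \<in> {1..m} \<rightarrow> J" and q: "q \<in> {1..m}"
    and \<Psi>: "\<Psi> \<in> borel_measurable (Pi\<^sub>M J (\<lambda>_. D))" "\<And>w. \<bar>\<Psi> w\<bar> \<le> C"
      "determined_on (J - i ` ({1..m} - {q})) \<Psi>"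
  shows "(\<integral>w. \<Psi> w * k (\<lambda>j. w (i j)) \<partial>Pi\<^sub>M J (\<lambda>_. D)) = 0"
proof -
  interpret P: product_sigma_finite "\<lambda>_ :: 'i. D" ..
  interpret PJ: prob_space "Pi\<^sub>M J (\<lambda>_. D)" by (intro prob_space_PiM prob_space_axioms)
  let ?L = "i ` ({1..m} - {q})"
  let ?K = "J - ?L"
  have J: "?K \<union> ?L = J" using i(2) by auto
  have iq: "i q \<notin> ?L" using inj_on_image_mem_iff[OF i(1) q, of "{1..m} - {q}"] by simp
  then have iqK: "i q \<in> ?K" using i(2) q by (simp add: Pi_iff)
  have int: "integrable (Pi\<^sub>M J (\<lambda>_. D)) (\<lambda>w. \<Psi> w * k (\<lambda>j. w (i j)))"
  proof (rule PJ.integrable_const_bound[where B = "C * B"])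
    show "AE w in Pi\<^sub>M J (\<lambda>_. D). norm (\<Psi> w * k (\<lambda>j. w (i j))) \<le> C * B"
      using \<Psi>(2) kernel_bound by (intro AE_I2) (auto simp: abs_mult intro!: mult_mono order_trans[OF abs_ge_zero])
  qed (intro borel_measurable_times \<Psi> measurable_kernel_comp i)
  have "(\<integral>w. \<Psi> w * k (\<lambda>j. w (i j)) \<partial>Pi\<^sub>M J (\<lambda>_. D)) =
      (\<integral>x. \<integral>y. \<Psi> (merge ?K ?L (x, y)) * k (\<lambda>j. merge ?K ?L (x, y) (i j))
        \<partial>Pi\<^sub>M ?L (\<lambda>_. D) \<partial>Pi\<^sub>M ?K (\<lambda>_. D))"
    using P.product_integral_fold[of ?K ?L "\<lambda>w. \<Psi> w * k (\<lambda>j. w (i j))"] int \<open>finite J\<close>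
    unfolding J by auto
  also have "\<dots> = (\<integral>x. 0 \<partial>Pi\<^sub>M ?K (\<lambda>_. D))"
  proof (intro Bochner_Integration.integral_cong refl)
    fix x assume x: "x \<in> space (Pi\<^sub>M ?K (\<lambda>_. D))"
    \<comment> \<open>With \<open>x\<close> fixed, \<open>\<Psi>\<close> is a constant. The index
      \<open>i q\<close> belongs to \<open>?K\<close>, so \<open>x (i q)\<close> is the fixed
      argument of the kernel.\<close>
    have "\<Psi> (merge ?K ?L (x, y)) * k (\<lambda>j. merge ?K ?L (x, y) (i j)) =
        \<Psi> x * k (\<lambda>j. if j = q then x (i q) else y (i j))" for y
    proof -
      have "\<Psi> (merge ?K ?L (x, y)) = \<Psi> x"
        by (rule determined_onD[OF \<Psi>(3)]) (simp add: merge_def)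
      moreover have "k (\<lambda>j. merge ?K ?L (x, y) (i j)) = k (\<lambda>j. if j = q then x (i q) else y (i j))"
        by (rule determined_onD[OF kernel_determined]) (use iq iqK in \<open>simp add: merge_def\<close>)
      ultimately show ?thesis by simp
    qed
    moreover have "x (i q) \<in> space D" using x iqK by (simp add: space_PiM PiE_iff)
    ultimately show "(\<integral>y. \<Psi> (merge ?K ?L (x, y)) * k (\<lambda>j. merge ?K ?L (x, y) (i j))
        \<partial>Pi\<^sub>M ?L (\<lambda>_. D)) = 0"
      using integral_kernel_fixed_point[OF i(1) q] by simp
  qed
  finally show ?thesis by simp
qed

text \<open>With at most one shared index, some position \<open>q\<close> of \<open>j\<close>
  accounts for the whole overlap; the kernel at \<open>i\<close> then plays the part of
  \<open>\<Psi>\<close>.\<close>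

lemma integral_kernel_product_eq_0:
  assumes i: "i \<in> increasing_tuples m n" and j: "j \<in> increasing_tuples m n"
    and overlap: "\<not> 2 \<le> card (i ` {1..m} \<inter> j ` {1..m})"
  shows "(\<integral>w. k (\<lambda>l. w (i l)) * k (\<lambda>l. w (j l)) \<partial>Pi\<^sub>M {1..n} (\<lambda>_. D)) = 0"
proof -
  have "\<exists>q\<in>{1..m}. i ` {1..m} \<inter> j ` {1..m} \<subseteq> {j q}"
  proof (cases "i ` {1..m} \<inter> j ` {1..m} = {}")
    case True
    \<comment> \<open>For disjoint images any position serves; \<open>1\<close> exists because
      \<open>2 \<le> m\<close>.\<close>
    then show ?thesis using order by (intro bexI[of _ 1]) auto
  next
    case False
    then have "card (i ` {1..m} \<inter> j ` {1..m}) \<noteq> 0" by simp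
    with overlap have "card (i ` {1..m} \<inter> j ` {1..m}) = 1" by linarith
    then obtain p where p: "i ` {1..m} \<inter> j ` {1..m} = {p}" using card_1_singletonE by metis
    then obtain q where "q \<in> {1..m}" "p = j q" by blast
    then show ?thesis using p by blast
  qed
  then obtain q where q: "q \<in> {1..m}" and sub: "i ` {1..m} \<inter> j ` {1..m} \<subseteq> {j q}" by blast
  note D = increasing_tuplesD
  have disj: "i ` {1..m} \<subseteq> {1..n} - j ` ({1..m} - {q})"
  proof (intro subsetI DiffI notI)
    fix p assume p: "p \<in> i ` {1..m}"
    then show "p \<in> {1..n}" using D(1)[OF i] by blast
    assume "p \<in> j ` ({1..m} - {q})"
    then obtain l where "l \<in> {1..m}" "l \<noteq> q" "p = j l" by blast
    moreover have "p = j q" using calculation p sub by blast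
    ultimately show False using q inj_onD[OF D(2)[OF j], of l q] by simp
  qed
  show ?thesis
  proof (rule integral_times_kernel_eq_0[OF _ D(2)[OF j] D(1)[OF j] q measurable_kernel_comp[OF D(1)[OF i]]
        kernel_bound])
    show "determined_on ({1..n} - j ` ({1..m} - {q})) (\<lambda>w. k (\<lambda>l. w (i l)))"
      unfolding determined_on_def using disj by (auto intro!: determined_onD[OF kernel_determined])
  qed simp
qed

lemma integral_kernel_eq_0:
  assumes "i \<in> increasing_tuples m n"
  shows "(\<integral>w. k (\<lambda>l. w (i l)) \<partial>Pi\<^sub>M {1..n} (\<lambda>_. D)) = 0"
  using integral_times_kernel_eq_0[of "{1..n}" i 1 "\<lambda>_. 1" 1] increasing_tuplesD[OF assms] order
  by (simp add: determined_on_def)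

section \<open>The U-statistic: mean, second moment, convergence\<close>

definition U :: "nat \<Rightarrow> (nat \<Rightarrow> 'b) \<Rightarrow> real" where
  "U n w = (\<Sum>i\<in>increasing_tuples m n. k (\<lambda>j. w (i j))) / real (n choose m)"

lemma measurable_U: "U n \<in> borel_measurable (Pi\<^sub>M {1..n} (\<lambda>_. D))"
  unfolding U_def
  by (intro borel_measurable_divide borel_measurable_sum measurable_kernel_comp increasing_tuplesD) auto

lemma determined_on_U: "determined_on {1..n} (U n)"
  unfolding determined_on_def U_def
  by (intro allI impI arg_cong2[where f = "(/)"] sum.cong refl determined_onD[OF kernel_determined])
     (use increasing_tuplesD(1) in fast)

lemma integrable_PiM_bounded:
  fixes f :: "(nat \<Rightarrow> 'b) \<Rightarrow> real"
  assumes "f \<in> borel_measurable (Pi\<^sub>M {1..n} (\<lambda>_. D))" "\<And>w. \<bar>f w\<bar> \<le> C"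
  shows "integrable (Pi\<^sub>M {1..n} (\<lambda>_. D)) f"
proof -
  interpret P: prob_space "Pi\<^sub>M {1..n} (\<lambda>_. D)" by (intro prob_space_PiM prob_space_axioms)
  show ?thesis using assms by (intro P.integrable_const_bound[where B = C]) auto
qed

lemma integrable_kernel:
  "i \<in> increasing_tuples m n \<Longrightarrow> integrable (Pi\<^sub>M {1..n} (\<lambda>_. D)) (\<lambda>w. k (\<lambda>l. w (i l)))"
  by (rule integrable_PiM_bounded[OF measurable_kernel_comp kernel_bound]) (rule increasing_tuplesD)

lemma abs_kernel_product_le: "\<bar>k w * k w'\<bar> \<le> B\<^sup>2"
  unfolding abs_mult power2_eq_square
  using kernel_bound by (intro mult_mono) (auto intro: order_trans[OF abs_ge_zero])

lemma integrable_kernel_product: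
  "i \<in> increasing_tuples m n \<Longrightarrow> j \<in> increasing_tuples m n \<Longrightarrow>
    integrable (Pi\<^sub>M {1..n} (\<lambda>_. D)) (\<lambda>w. k (\<lambda>l. w (i l)) * k (\<lambda>l. w (j l)))"
  by (rule integrable_PiM_bounded[OF borel_measurable_times[OF measurable_kernel_comp measurable_kernel_comp]
        abs_kernel_product_le]) (auto dest: increasing_tuplesD(1))

text \<open>Each summand has mean zero. For \<open>n < m\<close> there are no increasing tuples, so
  \<open>U n\<close> is zero and no case distinction arises.\<close>

lemma integral_U: "(\<integral>w. U n w \<partial>Pi\<^sub>M {1..n} (\<lambda>_. D)) = 0"
  unfolding U_def by (simp add: integrable_kernel integral_kernel_eq_0)

lemma U_square:
  "(U n w)\<^sup>2 = (\<Sum>i\<in>increasing_tuples m n. \<Sum>j\<in>increasing_tuples m n.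
      k (\<lambda>l. w (i l)) * k (\<lambda>l. w (j l))) / (real (n choose m))\<^sup>2"
  by (simp add: U_def power2_eq_square sum_product)

lemma integrable_U_square: "integrable (Pi\<^sub>M {1..n} (\<lambda>_. D)) (\<lambda>w. (U n w)\<^sup>2)"
  unfolding U_square by (intro integrable_divide Bochner_Integration.integrable_sum integrable_kernel_product)

text \<open>Expanding the square, pairs with at most one common index integrate to zero, the others
  to at most \<open>B\<^sup>2\<close>, and \<open>card_overlapping_tuples\<close> counts the
  latter.\<close>

lemma integral_U_square_le:
  assumes "m \<le> n"
  shows "real n * (\<integral>w. (U n w)\<^sup>2 \<partial>Pi\<^sub>M {1..n} (\<lambda>_. D)) \<le>
    B\<^sup>2 * (2 * (real (m choose 2))\<^sup>2 / (real n - 1))"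
proof -
  interpret P: prob_space "Pi\<^sub>M {1..n} (\<lambda>_. D)" by (intro prob_space_PiM prob_space_axioms)
  let ?I = "increasing_tuples m n"
  let ?E = "\<lambda>i j. \<integral>w. k (\<lambda>l. w (i l)) * k (\<lambda>l. w (j l)) \<partial>Pi\<^sub>M {1..n} (\<lambda>_. D)"
  let ?O = "\<lambda>i j. 2 \<le> card (i ` {1..m} \<inter> j ` {1..m})"
  let ?N = "(n choose 2) * ((n - 2) choose (m - 2))\<^sup>2"
  have E: "?E i j \<le> B\<^sup>2 * of_bool (?O i j)" if "i \<in> ?I" "j \<in> ?I" for i j
  proof (cases "?O i j")
    case True
    have "?E i j \<le> (\<integral>w. B\<^sup>2 \<partial>Pi\<^sub>M {1..n} (\<lambda>_. D))"
      using abs_kernel_product_le that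
      by (intro integral_mono integrable_kernel_product P.integrable_const)
         (auto intro: order_trans[OF abs_ge_self])
    then show ?thesis using True by (simp add: P.prob_space)
  next
    case False
    then show ?thesis using integral_kernel_product_eq_0[OF that False] by simp
  qed
  have "(\<integral>w. (U n w)\<^sup>2 \<partial>Pi\<^sub>M {1..n} (\<lambda>_. D)) = (\<Sum>i\<in>?I. \<Sum>j\<in>?I. ?E i j) / (real (n choose m))\<^sup>2"
    unfolding U_square by (simp add: integrable_kernel_product)
  also have "(\<Sum>i\<in>?I. \<Sum>j\<in>?I. ?E i j) \<le> (\<Sum>i\<in>?I. \<Sum>j\<in>?I. B\<^sup>2 * of_bool (?O i j))"
    using E by (intro sum_mono)
  also have "\<dots> = B\<^sup>2 * real (card {(i, j) \<in> ?I \<times> ?I. ?O i j})"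
    unfolding sum.cartesian_product sum_distrib_left[symmetric] case_prod_beta'
    using finite_increasing_tuples[of m n]
    by (subst sum_of_bool_eq) (auto intro!: arg_cong[of _ _ card])
  also have "\<dots> \<le> B\<^sup>2 * real ?N"
    using card_overlapping_tuples[OF order, of n]
    by (intro mult_left_mono) (simp_all only: of_nat_le_iff zero_le_power2)
  finally have "(\<integral>w. (U n w)\<^sup>2 \<partial>Pi\<^sub>M {1..n} (\<lambda>_. D)) \<le> B\<^sup>2 * real ?N / (real (n choose m))\<^sup>2"
    by (simp add: divide_right_mono)
  then have "real n * (\<integral>w. (U n w)\<^sup>2 \<partial>Pi\<^sub>M {1..n} (\<lambda>_. D)) \<le>
      real n * (B\<^sup>2 * real ?N / (real (n choose m))\<^sup>2)"
    by (rule mult_left_mono) simp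
  also have "\<dots> = B\<^sup>2 * (real n * real ?N / (real (n choose m))\<^sup>2)" by simp
  finally show ?thesis unfolding overlap_ratio_bound[OF order assms] .
qed

text \<open>The first two moments of \<open>U n\<close> are transferred to \<open>M\<close> through
  the joint law of the first \<open>n\<close> observations; Markov's inequality for the square then
  gives a bound of order \<open>1/n\<close>.\<close>

lemma U_tendsto:
  fixes M :: "'o measure" and Z :: "nat \<Rightarrow> 'o \<Rightarrow> 'b"
  assumes M: "prob_space M" and Z: "\<And>n i. i \<in> {1..n} \<Longrightarrow> Z i \<in> measurable M D"
    and law: "\<And>n. distr M (Pi\<^sub>M {1..n} (\<lambda>_. D)) (\<lambda>\<omega>. \<lambda>i\<in>{1..n}. Z i \<omega>) = Pi\<^sub>M {1..n} (\<lambda>_. D)"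
  shows "tendsto_zero_in_prob M (\<lambda>n \<omega>. sqrt (real n) *
    (U n (\<lambda>i. Z i \<omega>) - (\<integral>\<omega>'. U n (\<lambda>i. Z i \<omega>') \<partial>M)))"
proof -
  interpret M: prob_space M by fact
  have Zm: "(\<lambda>\<omega>. \<lambda>i\<in>{1..n}. Z i \<omega>) \<in> measurable M (Pi\<^sub>M {1..n} (\<lambda>_. D))" for n
    using Z by (rule measurable_restrict)
  have U_eq: "U n (\<lambda>i. Z i \<omega>) = U n (\<lambda>i\<in>{1..n}. Z i \<omega>)" for n \<omega>
    by (intro determined_onD[OF determined_on_U]) simp
  have mean: "(\<integral>\<omega>. U n (\<lambda>i. Z i \<omega>) \<partial>M) = 0" for n
    using integral_distr[OF Zm[of n] measurable_U[of n]] integral_U[of n] by (simp add: law U_eq)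
  have meas: "(\<lambda>\<omega>. U n (\<lambda>i. Z i \<omega>)) \<in> borel_measurable M" for n
    unfolding U_eq by (rule measurable_compose[OF Zm measurable_U])
  have second: "(\<integral>\<omega>. (U n (\<lambda>i. Z i \<omega>))\<^sup>2 \<partial>M) = (\<integral>w. (U n w)\<^sup>2 \<partial>Pi\<^sub>M {1..n} (\<lambda>_. D))" for n
    using integral_distr[OF Zm[of n] borel_measurable_power[OF measurable_U[of n]], of 2]
    by (simp add: law U_eq)
  have int: "integrable M (\<lambda>\<omega>. (U n (\<lambda>i. Z i \<omega>))\<^sup>2)" for n
    using integrable_distr[OF Zm[of n], of "\<lambda>w. (U n w)\<^sup>2"] integrable_U_square[of n]
    by (simp add: law U_eq)
  show ?thesis
    unfolding tendsto_zero_in_prob_def mean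
  proof (intro allI impI)
    fix \<epsilon> :: real assume "\<epsilon> > 0"
    \<comment> \<open>The constant of \<open>integral_U_square_le\<close> divided by
      \<open>\<epsilon>\<^sup>2\<close>, with the dependence on \<open>n\<close> left out.\<close>
    let ?c = "B\<^sup>2 * (2 * (real (m choose 2))\<^sup>2) / \<epsilon>\<^sup>2"
    have bound: "M.prob {\<omega> \<in> space M. \<bar>sqrt (real n) * (U n (\<lambda>i. Z i \<omega>) - 0)\<bar> > \<epsilon>} \<le> ?c / (real n - 1)"
      if "m \<le> n" for n
    proof -
      have "M.prob {\<omega> \<in> space M. \<bar>sqrt (real n) * (U n (\<lambda>i. Z i \<omega>) - 0)\<bar> > \<epsilon>} \<le>
          M.prob {\<omega> \<in> space M. real n * (U n (\<lambda>i. Z i \<omega>))\<^sup>2 \<ge> \<epsilon>\<^sup>2}"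
      proof (intro M.finite_measure_mono subsetI CollectI conjI)
        fix \<omega> assume "\<omega> \<in> {\<omega> \<in> space M. \<bar>sqrt (real n) * (U n (\<lambda>i. Z i \<omega>) - 0)\<bar> > \<epsilon>}"
        then have "\<omega> \<in> space M" "\<epsilon>\<^sup>2 \<le> \<bar>sqrt (real n) * U n (\<lambda>i. Z i \<omega>)\<bar>\<^sup>2"
          using \<open>\<epsilon> > 0\<close> power_mono[of \<epsilon> "\<bar>sqrt (real n) * U n (\<lambda>i. Z i \<omega>)\<bar>" 2] by simp_all
        then show "\<omega> \<in> space M" "real n * (U n (\<lambda>i. Z i \<omega>))\<^sup>2 \<ge> \<epsilon>\<^sup>2"
          by (simp_all add: power_mult_distrib)
      next
        show "{\<omega> \<in> space M. real n * (U n (\<lambda>i. Z i \<omega>))\<^sup>2 \<ge> \<epsilon>\<^sup>2} \<in> sets M"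
          using meas[of n] by measurable
      qed
      also have "\<dots> \<le> (\<integral>\<omega>. real n * (U n (\<lambda>i. Z i \<omega>))\<^sup>2 \<partial>M) / \<epsilon>\<^sup>2"
        using \<open>\<epsilon> > 0\<close> int by (intro integral_Markov_inequality_measure[where A = "{}"]) auto
      also have "(\<integral>\<omega>. real n * (U n (\<lambda>i. Z i \<omega>))\<^sup>2 \<partial>M) \<le>
          B\<^sup>2 * (2 * (real (m choose 2))\<^sup>2 / (real n - 1))"
        using integral_U_square_le[OF that] by (simp add: second)
      finally show ?thesis
        by (simp add: divide_right_mono ac_simps)
    qed
    have lim: "(\<lambda>n. ?c / (real n - 1)) \<longlonglongrightarrow> 0" by real_asymp
    show "(\<lambda>n. M.prob {\<omega> \<in> space M. \<bar>sqrt (real n) * (U n (\<lambda>i. Z i \<omega>) - 0)\<bar> > \<epsilon>}) \<longlonglongrightarrow> 0"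
      \<comment> \<open>The upper bound is available from \<open>n = m\<close> on, which suffices
        for the limit.\<close>
      by (rule tendsto_sandwich[OF _ _ tendsto_const lim])
         (rule always_eventually, simp, rule eventually_sequentiallyI[of m], rule bound)
  qed
qed

end
subsection \<open>The kernel of a symmetric rank covariance\<close>

lemma sets_borel_prod:
  fixes D :: "'a :: second_countable_topology measure" and E :: "'b :: second_countable_topology measure"
  shows "sets D = sets borel \<Longrightarrow> sets E = sets borel \<Longrightarrow> sets (D \<Otimes>\<^sub>M E) = sets borel"
  unfolding borel_prod[symmetric] by (rule sets_pair_measure_cong)

lemma determined_on_permute:
  fixes f :: "(nat \<Rightarrow> 'a) \<Rightarrow> 'b"
  assumes "\<sigma> permutes {1..m}" "determined_on {1..m} f"
  shows "determined_on {1..m} (\<lambda>w. f (permute_tuple \<sigma> w))"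
  unfolding determined_on_def
proof (intro allI impI)
  fix w w' :: "nat \<Rightarrow> 'a" assume "\<forall>j\<in>{1..m}. w j = w' j"
  then show "f (permute_tuple \<sigma> w) = f (permute_tuple \<sigma> w')"
    using permutes_in_image[OF permutes_inv[OF assms(1)]]
    by (intro determined_onD[OF assms(2)]) (simp add: permute_tuple_def)
qed

locale rank_kernel =
  fixes m :: nat
    and IX :: "(nat \<Rightarrow> real ^ 'r) \<Rightarrow> real" and IY :: "(nat \<Rightarrow> real ^ 's) \<Rightarrow> real"
    and H :: "(nat \<Rightarrow> nat) set"
  assumes IX: "rank_indicator m IX" and IY: "rank_indicator m IY"
    and H: "subgroup H (sym_group m)"
begin

lemma permutes_H: "h \<in> H \<Longrightarrow> h permutes {1..m}"
  using subgroup.subset[OF H] by (auto simp: sym_group_carrier)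

lemma finite_H: "finite H"
  using permutes_H by (intro finite_subset[OF _ finite_permutations[of "{1..m}"]]) auto

section \<open>Signed sums over \<open>H\<close>: dependence, bounds, measurability\<close>

definition signed_sum :: "((nat \<Rightarrow> 'c) \<Rightarrow> real) \<Rightarrow> (nat \<Rightarrow> 'c) \<Rightarrow> real" where
  "signed_sum I w = (\<Sum>h\<in>H. of_int (sign h) * I (permute_tuple h w))"

lemma src_kernel_eq:
  "src_kernel IX IY H z = signed_sum IX (\<lambda>i. fst (z i)) * signed_sum IY (\<lambda>i. snd (z i))"
  by (simp add: src_kernel_def signed_sum_def)

lemma determined_on_signed_sum: "determined_on {1..m} I \<Longrightarrow> determined_on {1..m} (signed_sum I)"
  unfolding determined_on_def[of _ "signed_sum I"] signed_sum_def
  by (auto intro!: sum.cong arg_cong2[where f = "(*)"]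
      intro: determined_onD[OF determined_on_permute[OF permutes_H]])

lemma abs_signed_sum_le:
  assumes "\<And>w. \<bar>I w\<bar> \<le> 1"
  shows "\<bar>signed_sum I w\<bar> \<le> real (card H)"
proof -
  have "\<bar>signed_sum I w\<bar> \<le> (\<Sum>h\<in>H. \<bar>of_int (sign h) * I (permute_tuple h w)\<bar>)"
    unfolding signed_sum_def by (rule sum_abs)
  also have "\<dots> \<le> (\<Sum>h\<in>H. 1)"
    using assms by (intro sum_mono) (simp add: abs_mult sign_def)
  finally show ?thesis by simp
qed

lemma measurable_signed_sum:
  fixes I :: "(nat \<Rightarrow> real ^ 'd) \<Rightarrow> real"
  assumes "rank_indicator m I" and "\<And>j. j \<in> {1..m} \<Longrightarrow> (\<lambda>\<omega>. f \<omega> j) \<in> borel_measurable N"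
  shows "(\<lambda>\<omega>. signed_sum I (f \<omega>)) \<in> borel_measurable N"
  unfolding signed_sum_def
proof (intro borel_measurable_sum borel_measurable_times borel_measurable_const)
  fix h assume "h \<in> H"
  then show "(\<lambda>\<omega>. I (permute_tuple h (f \<omega>))) \<in> borel_measurable N"
    using assms(2) permutes_in_image[OF permutes_inv[OF permutes_H]]
    by (intro measurable_rank_indicator[OF assms(1)]) (simp add: permute_tuple_def)
qed

lemma determined_on_src_kernel: "determined_on {1..m} (src_kernel IX IY H)"
  unfolding determined_on_def src_kernel_eq
  by (auto intro!: arg_cong2[where f = "(*)"]
      intro: determined_onD[OF determined_on_signed_sum[OF determined_on_rank_indicator]] IX IY)

lemma abs_src_kernel_le: "\<bar>src_kernel IX IY H z\<bar> \<le> (real (card H))\<^sup>2"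
  unfolding src_kernel_eq abs_mult power2_eq_square
  by (intro mult_mono abs_signed_sum_le rank_indicator_bound[OF IX] rank_indicator_bound[OF IY]) auto

lemma measurable_src_kernel:
  assumes "\<And>j. j \<in> {1..m} \<Longrightarrow> (\<lambda>\<omega>. z \<omega> j) \<in> borel_measurable N"
  shows "(\<lambda>\<omega>. src_kernel IX IY H (z \<omega>)) \<in> borel_measurable N"
  unfolding src_kernel_eq
  by (intro borel_measurable_times measurable_signed_sum IX IY measurable_compose[OF assms]
      borel_measurable_continuous_onI continuous_on_fst continuous_on_snd continuous_on_id)

lemma measurable_src_kernel_permute:
  assumes "\<sigma> permutes {1..m}" and "\<And>j. j \<in> {1..m} \<Longrightarrow> (\<lambda>\<omega>. z \<omega> j) \<in> borel_measurable N"
  shows "(\<lambda>\<omega>. src_kernel IX IY H (permute_tuple \<sigma> (z \<omega>))) \<in> borel_measurable N"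
  unfolding permute_tuple_def using assms(2) permutes_in_image[OF permutes_inv[OF assms(1)]]
  by (intro measurable_src_kernel) simp

lemma determined_on_src_kappa: "determined_on {1..m} (src_kappa m IX IY H)"
  unfolding determined_on_def[of _ "src_kappa m IX IY H"] src_kappa_def
  by (auto intro!: sum.cong arg_cong2[where f = "(/)"] simp: sym_group_carrier
      intro: determined_onD[OF determined_on_permute[OF _ determined_on_src_kernel]])

lemma abs_src_kappa_le: "\<bar>src_kappa m IX IY H z\<bar> \<le> (real (card H))\<^sup>2"
proof -
  have "\<bar>\<Sum>\<sigma>\<in>carrier (sym_group m). src_kernel IX IY H (permute_tuple \<sigma> z)\<bar> \<le>
      (\<Sum>\<sigma>\<in>carrier (sym_group m). (real (card H))\<^sup>2)"
    using sum_abs by (rule order_trans) (intro sum_mono abs_src_kernel_le)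
  also have "\<dots> = fact m * (real (card H))\<^sup>2"
    by (simp add: sym_group_def card_permutations)
  finally show ?thesis
    unfolding src_kappa_def by (simp add: divide_le_eq ac_simps)
qed

text \<open>Stated for any tuple-valued map with measurable entries, so that it also covers tuples
  in which one entry is replaced by a constant.\<close>

lemma measurable_src_kappa:
  assumes "\<And>j. j \<in> {1..m} \<Longrightarrow> (\<lambda>\<omega>. z \<omega> j) \<in> borel_measurable N"
  shows "(\<lambda>\<omega>. src_kappa m IX IY H (z \<omega>)) \<in> borel_measurable N"
  unfolding src_kappa_def
  by (intro borel_measurable_divide borel_measurable_sum borel_measurable_const)
     (rule measurable_src_kernel_permute[OF _ assms], simp_all add: sym_group_carrier)

text \<open>The law of a permuted i.i.d. tuple with the value \<open>a\<close> planted at position \<open>q\<close> depends only on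
  the position at which \<open>a\<close> ends up, and the integral of \<open>I\<close> only on the \<open>G\<close>-orbit of that position.\<close>

lemma integral_signed_sum_eq_0:
  fixes I :: "(nat \<Rightarrow> real ^ 'd) \<Rightarrow> real" and D :: "(real ^ 'd) measure"
  assumes D: "prob_space D" "sets D = sets borel" and I: "rank_indicator m I"
    and G: "G \<subseteq> invariance_group m I" "equiv H (position_rel G H (\<sigma> q))"
    and classes: "\<And>C. C \<in> H // position_rel G H (\<sigma> q) \<Longrightarrow> equally_many_even_odd C"
    and \<sigma>: "\<sigma> permutes {1..m}"
  shows "(\<integral>x. signed_sum I (permute_tuple \<sigma> (x(q := a))) \<partial>Pi\<^sub>M {1..m} (\<lambda>_. D)) = 0"
proof -
  let ?P = "Pi\<^sub>M {1..m} (\<lambda>_. D)"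
  interpret P: prob_space ?P by (intro prob_space_PiM D)
  note det = determined_on_rank_indicator[OF I]
  have coord: "(\<lambda>x. (x(p := a)) j) \<in> borel_measurable ?P" if "j \<in> {1..m}" for p j
    using measurable_component_singleton[OF that, of "\<lambda>_. D"]
    by (cases "j = p") (simp_all add: measurable_cong_sets[OF refl D(2)])
  have meas: "(\<lambda>x. I (x(p := a))) \<in> borel_measurable ?P" for p
    by (intro measurable_rank_indicator[OF I] coord)
  have meas': "(\<lambda>x. I (permute_tuple \<tau> (x(q := a)))) \<in> borel_measurable ?P"
    if "\<tau> permutes {1..m}" for \<tau>
    using permutes_in_image[OF permutes_inv[OF that]]
    by (intro measurable_rank_indicator[OF I]) (simp only: permute_tuple_def coord)
  define \<Phi> where "\<Phi> p = (\<integral>x. I (x(p := a)) \<partial>?P)" for p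
  have move: "(\<integral>x. I (permute_tuple \<tau> (x(p := a))) \<partial>?P) = \<Phi> (\<tau> p)" if "\<tau> permutes {1..m}" for \<tau> p
    unfolding \<Phi>_def by (rule integral_permute_upd[OF D(1) that det meas])
  have orbit: "\<Phi> (g p) = \<Phi> p" if "g \<in> G" for g p
  proof -
    have g: "g permutes {1..m}" "\<And>w. I (permute_tuple g w) = I w"
      using that G(1) by (auto simp: invariance_group_iff)
    show ?thesis using move[OF g(1), of p] unfolding g(2) by (simp add: \<Phi>_def)
  qed
  have comp: "h \<circ> \<sigma> permutes {1..m}" if "h \<in> H" for h
    using permutes_compose[OF \<sigma> permutes_H[OF that]] .
  have comp_eq: "permute_tuple h (permute_tuple \<sigma> w) = permute_tuple (h \<circ> \<sigma>) w" if "h \<in> H" for h and w :: "nat \<Rightarrow> real ^ 'd"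
    using permutes_bij[OF \<sigma>] permutes_bij[OF permutes_H[OF that]] by (rule permute_tuple_comp[rotated])
  have "(\<integral>x. signed_sum I (permute_tuple \<sigma> (x(q := a))) \<partial>?P) =
      (\<integral>x. (\<Sum>h\<in>H. of_int (sign h) * I (permute_tuple (h \<circ> \<sigma>) (x(q := a)))) \<partial>?P)"
    unfolding signed_sum_def by (intro Bochner_Integration.integral_cong refl sum.cong) (simp add: comp_eq)
  also have "\<dots> = (\<Sum>h\<in>H. \<integral>x. of_int (sign h) * I (permute_tuple (h \<circ> \<sigma>) (x(q := a))) \<partial>?P)"
    by (intro Bochner_Integration.integral_sum integrable_mult_right P.integrable_const_bound[where B = 1])
       (use rank_indicator_bound[OF I] meas' comp in auto)
  also have "\<dots> = (\<Sum>h\<in>H. of_int (sign h) * \<Phi> (h (\<sigma> q)))"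
    using move[OF comp, of _ q] by (intro sum.cong) simp_all
  \<comment> \<open>By \<open>orbit\<close>, \<open>\<Phi> (h (\<sigma> q))\<close> is constant on
    the classes of \<open>position_rel G H (\<sigma> q)\<close>.\<close>
  also have "\<dots> = 0"
    by (rule sum_sign_eq_0[OF finite_H G(2) classes]) (use orbit in \<open>auto simp: position_rel_def, metis\<close>)
  finally show ?thesis .
qed

text \<open>Under a product law the kernel is a function of the first components times a function of
  the second, and Fubini separates them. The first factor has integral zero.\<close>

lemma integral_src_kernel_eq_0:
  fixes DX :: "(real ^ 'r) measure" and DY :: "(real ^ 's) measure"
  assumes DX: "prob_space DX" "sets DX = sets borel" and DY: "prob_space DY" "sets DY = sets borel"
    and G: "G = invariance_group m IX \<inter> invariance_group m IY"
    and classes: "\<forall>i\<in>{1..m}. \<forall>C \<in> H // position_rel G H i. equally_many_even_odd C"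
    and q: "q \<in> {1..m}" and \<sigma>: "\<sigma> permutes {1..m}"
  shows "(\<integral>z. src_kernel IX IY H (permute_tuple \<sigma> (z(q := a))) \<partial>Pi\<^sub>M {1..m} (\<lambda>_. DX \<Otimes>\<^sub>M DY)) = 0"
proof -
  let ?PX = "Pi\<^sub>M {1..m} (\<lambda>_. DX)" and ?PY = "Pi\<^sub>M {1..m} (\<lambda>_. DY)"
  let ?P = "Pi\<^sub>M {1..m} (\<lambda>_. DX \<Otimes>\<^sub>M DY)"
  let ?zip = "\<lambda>(x, y). \<lambda>i\<in>{1..m}. (x i, y i)"
  interpret PX: prob_space ?PX by (intro prob_space_PiM DX)
  interpret PY: prob_space ?PY by (intro prob_space_PiM DY)
  interpret PXY: pair_prob_space ?PX ?PY ..
  have sets: "sets (DX \<Otimes>\<^sub>M DY) = sets borel"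
    using DX(2) DY(2) by (rule sets_borel_prod)
  have zip: "?zip \<in> measurable (?PX \<Otimes>\<^sub>M ?PY) ?P"
    unfolding case_prod_beta by measurable
  have coord: "(\<lambda>z. (z(q := a)) j) \<in> borel_measurable ?P" if "j \<in> {1..m}" for j
    using measurable_component_singleton[OF that, of "\<lambda>_. DX \<Otimes>\<^sub>M DY"]
    by (cases "j = q") (simp_all add: measurable_cong_sets[OF refl sets])
  define fX where "fX x = signed_sum IX (permute_tuple \<sigma> (x(q := fst a)))" for x
  define fY where "fY y = signed_sum IY (permute_tuple \<sigma> (y(q := snd a)))" for y
  \<comment> \<open>The class condition is used at position \<open>\<sigma> q\<close>, which stays
    in \<open>{1..m}\<close>; \<open>G\<close> lies in the invariance group of
    \<open>IX\<close>.\<close>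
  have fX0: "(\<integral>x. fX x \<partial>?PX) = 0"
    unfolding fX_def
    by (rule integral_signed_sum_eq_0[OF DX IX _ equiv_position_rel[OF G] _ \<sigma>])
       (use G classes permutes_in_image[OF \<sigma>] q in auto)
  \<comment> \<open>The zipped tuple is \<open>undefined\<close> outside \<open>{1..m}\<close>, so
    the factors are compared on the positions that matter only.\<close>
  have split: "src_kernel IX IY H (permute_tuple \<sigma> ((?zip xy)(q := a))) = fX (fst xy) * fY (snd xy)" for xy
    unfolding src_kernel_eq fX_def fY_def
    by (intro arg_cong2[where f = "(*)"]
         determined_onD[OF determined_on_signed_sum[OF determined_on_rank_indicator[OF IX]]]
         determined_onD[OF determined_on_signed_sum[OF determined_on_rank_indicator[OF IY]]])
       (use permutes_in_image[OF permutes_inv[OF \<sigma>]] in \<open>auto simp: permute_tuple_def case_prod_beta\<close>)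
  have meas: "(\<lambda>z. src_kernel IX IY H (permute_tuple \<sigma> (z(q := a)))) \<in> borel_measurable ?P"
    by (rule measurable_src_kernel_permute[OF \<sigma> coord])
  have "(\<integral>z. src_kernel IX IY H (permute_tuple \<sigma> (z(q := a))) \<partial>?P) =
      (\<integral>z. src_kernel IX IY H (permute_tuple \<sigma> (z(q := a))) \<partial>distr (?PX \<Otimes>\<^sub>M ?PY) ?P ?zip)"
    by (subst distr_PiM_pair[OF _ DX(1) DY(1)]) simp_all
  also have "\<dots> = (\<integral>xy. fX (fst xy) * fY (snd xy) \<partial>(?PX \<Otimes>\<^sub>M ?PY))"
    unfolding split[symmetric] by (rule integral_distr[OF zip meas])
  also have "\<dots> = (\<integral>x. \<integral>y. fX x * fY y \<partial>?PY \<partial>?PX)"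
  proof -
    have "(\<lambda>xy. fX (fst xy) * fY (snd xy)) \<in> borel_measurable (?PX \<Otimes>\<^sub>M ?PY)"
      unfolding split[symmetric] by (rule measurable_compose[OF zip meas])
    then have "integrable (?PX \<Otimes>\<^sub>M ?PY) (\<lambda>xy. fX (fst xy) * fY (snd xy))"
      using abs_src_kernel_le
      by (intro PXY.integrable_const_bound[where B = "(real (card H))\<^sup>2"]) (simp_all add: split[symmetric])
    from PXY.integral_fst'[OF this] show ?thesis by simp
  qed
  also have "\<dots> = 0" by (simp add: fX0)
  finally show ?thesis .
qed

text \<open>\<open>src_kappa\<close> averages the kernel over all permutations, and each term
  vanishes; this is why the preceding lemma carries a permutation \<open>\<sigma>\<close>.\<close>

lemma integral_src_kappa_eq_0:
  fixes DX :: "(real ^ 'r) measure" and DY :: "(real ^ 's) measure"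
  assumes DX: "prob_space DX" "sets DX = sets borel" and DY: "prob_space DY" "sets DY = sets borel"
    and G: "G = invariance_group m IX \<inter> invariance_group m IY"
    and classes: "\<forall>i\<in>{1..m}. \<forall>C \<in> H // position_rel G H i. equally_many_even_odd C"
    and q: "q \<in> {1..m}"
  shows "(\<integral>z. src_kappa m IX IY H (z(q := a)) \<partial>Pi\<^sub>M {1..m} (\<lambda>_. DX \<Otimes>\<^sub>M DY)) = 0"
proof -
  let ?P = "Pi\<^sub>M {1..m} (\<lambda>_. DX \<Otimes>\<^sub>M DY)"
  interpret DX: prob_space DX by fact
  interpret DY: prob_space DY by fact
  interpret DXY: pair_prob_space DX DY ..
  interpret P: prob_space ?P by (intro prob_space_PiM DXY.prob_space_axioms)
  have sets: "sets (DX \<Otimes>\<^sub>M DY) = sets borel"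
    using DX(2) DY(2) by (rule sets_borel_prod)
  have coord: "(\<lambda>z. (z(q := a)) j) \<in> borel_measurable ?P" if "j \<in> {1..m}" for j
    using measurable_component_singleton[OF that, of "\<lambda>_. DX \<Otimes>\<^sub>M DY"]
    by (cases "j = q") (simp_all add: measurable_cong_sets[OF refl sets])
  have int: "integrable ?P (\<lambda>z. src_kernel IX IY H (permute_tuple \<sigma> (z(q := a))))"
    if "\<sigma> permutes {1..m}" for \<sigma>
  proof (rule P.integrable_const_bound[where B = "(real (card H))\<^sup>2"])
    show "(\<lambda>z. src_kernel IX IY H (permute_tuple \<sigma> (z(q := a)))) \<in> borel_measurable ?P"
      by (rule measurable_src_kernel_permute[OF that coord])
  qed (simp add: abs_src_kernel_le)
  show ?thesis
    unfolding src_kappa_def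
    using int integral_src_kernel_eq_0[OF DX DY G classes q]
    by (simp add: sym_group_carrier)
qed

end

section \<open>Joint laws of the sample and of the pair\<close>

lemma distr_iid_tuple:
  fixes Z :: "nat \<Rightarrow> 'o \<Rightarrow> 'b :: topological_space"
  assumes M: "prob_space M" and Z: "prob_space.indep_vars M (\<lambda>_. borel) Z {1..}"
    and D: "\<And>i. 1 \<le> i \<Longrightarrow> distr M borel (Z i) = D"
  shows "distr M (Pi\<^sub>M {1..n} (\<lambda>_. D)) (\<lambda>\<omega>. \<lambda>i\<in>{1..n}. Z i \<omega>) = Pi\<^sub>M {1..n} (\<lambda>_. D)"
proof -
  interpret M: prob_space M by fact
  have Zm: "Z i \<in> borel_measurable M" if "1 \<le> i" for i
    using Z that unfolding M.indep_vars_def by simp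
  have sets: "sets D = sets borel" using D[of 1] by auto
  show ?thesis
  proof (cases "n = 0")
    \<comment> \<open>The description of independence by a product law is applied to nonempty index
      sets. For \<open>n = 0\<close> both sides are probability measures on a one-point
      space.\<close>
    case True
    interpret D: prob_space D using M.prob_space_distr[OF Zm[of 1]] D[of 1] by simp
    interpret PD: product_sigma_finite "\<lambda>_ :: nat. D" ..
    let ?E = "distr M (Pi\<^sub>M {1..n} (\<lambda>_. D)) (\<lambda>\<omega>. \<lambda>i\<in>{1..n}. Z i \<omega>)"
    interpret E: prob_space ?E
      using True by (intro M.prob_space_distr measurable_restrict) simp
    show ?thesis
    proof (rule PD.PiM_eqI)
      fix A
      have "Pi\<^sub>E {1..n} A = space ?E" using True by (simp add: space_PiM)
      then show "emeasure ?E (Pi\<^sub>E {1..n} A) = (\<Prod>i\<in>{1..n}. emeasure D (A i))"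
        using True E.emeasure_space_1 by simp
    qed simp_all
  next
    case False
    have "M.indep_vars (\<lambda>_. borel) Z {1..n}"
      by (rule M.indep_vars_subset[OF Z]) auto
    then have "distr M (Pi\<^sub>M {1..n} (\<lambda>_. borel)) (\<lambda>\<omega>. \<lambda>i\<in>{1..n}. Z i \<omega>) =
        Pi\<^sub>M {1..n} (\<lambda>i. distr M borel (Z i))"
      using False Zm by (subst (asm) M.indep_vars_iff_distr_eq_PiM') auto
    also have "\<dots> = Pi\<^sub>M {1..n} (\<lambda>_. D)"
      using D by (intro PiM_cong) auto
    also have "distr M (Pi\<^sub>M {1..n} (\<lambda>_. borel)) (\<lambda>\<omega>. \<lambda>i\<in>{1..n}. Z i \<omega>) =
        distr M (Pi\<^sub>M {1..n} (\<lambda>_. D)) (\<lambda>\<omega>. \<lambda>i\<in>{1..n}. Z i \<omega>)"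
      using sets by (intro distr_cong sets_PiM_cong) auto
    finally show ?thesis .
  qed
qed

text \<open>Independence is the product formula on rectangles, and rectangles determine the product
  measure.\<close>

lemma distr_indep_rvs:
  fixes X :: "'o \<Rightarrow> 'b :: second_countable_topology" and Y :: "'o \<Rightarrow> 'c :: second_countable_topology"
  assumes M: "prob_space M" and X: "X \<in> borel_measurable M" and Y: "Y \<in> borel_measurable M"
    and indep: "indep_rvs M X Y"
  shows "distr M borel X \<Otimes>\<^sub>M distr M borel Y = distr M borel (\<lambda>\<omega>. (X \<omega>, Y \<omega>))"
proof -
  interpret M: prob_space M by fact
  interpret DX: prob_space "distr M borel X" by (rule M.prob_space_distr[OF X])
  interpret DY: prob_space "distr M borel Y" by (rule M.prob_space_distr[OF Y])
  have XY: "(\<lambda>\<omega>. (X \<omega>, Y \<omega>)) \<in> borel_measurable M"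
    using measurable_Pair[OF X Y] by (simp add: borel_prod)
  show ?thesis
  proof (rule pair_measure_eqI)
    show "sets (distr M borel X \<Otimes>\<^sub>M distr M borel Y) = sets (distr M borel (\<lambda>\<omega>. (X \<omega>, Y \<omega>)))"
      using sets_borel_prod[of "distr M borel X" "distr M borel Y"] by simp
    fix A B assume "A \<in> sets (distr M borel X)" "B \<in> sets (distr M borel Y)"
    then have A: "A \<in> sets borel" and B: "B \<in> sets borel" by auto
    then have AB: "A \<times> B \<in> sets borel"
      unfolding borel_prod[symmetric] by (rule pair_measureI)
    have "M.prob ((X -` A \<inter> space M) \<inter> (Y -` B \<inter> space M)) =
        M.prob (X -` A \<inter> space M) * M.prob (Y -` B \<inter> space M)"
      using indep A B unfolding indep_rvs_def by (intro M.indep_setD) auto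
    moreover have "(X -` A \<inter> space M) \<inter> (Y -` B \<inter> space M) = (\<lambda>\<omega>. (X \<omega>, Y \<omega>)) -` (A \<times> B) \<inter> space M"
      by auto
    ultimately show "emeasure (distr M borel X) A * emeasure (distr M borel Y) B =
        emeasure (distr M borel (\<lambda>\<omega>. (X \<omega>, Y \<omega>))) (A \<times> B)"
      using A B AB X Y XY
      by (simp add: emeasure_distr M.emeasure_eq_measure flip: ennreal_mult')
  qed (unfold_locales)
qed

theorem proposition5p7:
  fixes m :: nat
    and IX :: "(nat \<Rightarrow> real ^ 'r) \<Rightarrow> real"
    and IY :: "(nat \<Rightarrow> real ^ 's) \<Rightarrow> real"
    and H G :: "(nat \<Rightarrow> nat) set"
    and \<mu> :: "((real ^ 'r) \<times> (real ^ 's)) measure \<Rightarrow> real"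
    and M :: "'o measure"
    and X :: "'o \<Rightarrow> real ^ 'r" and Y :: "'o \<Rightarrow> real ^ 's"
    and Z :: "nat \<Rightarrow> 'o \<Rightarrow> (real ^ 'r) \<times> (real ^ 's)"
  assumes src: "is_symmetric_rank_covariance m IX IY H \<mu>"
    and G: "G = invariance_group m IX \<inter> invariance_group m IY"
    and classes: "\<forall>i\<in>{1..m}. \<forall>C \<in> H // position_rel G H i. equally_many_even_odd C"
    and M: "prob_space M"
    and rv: "X \<in> borel_measurable M" "Y \<in> borel_measurable M"
    and iid: "iid_copies M Z (\<lambda>\<omega>. (X \<omega>, Y \<omega>))"
    and indep: "indep_rvs M X Y"
  shows "(\<forall>z. src_kappa1 m IX IY H M Z z = 0) \<and>
    tendsto_zero_in_prob M (\<lambda>n \<omega>. sqrt (real n) *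
      (src_U m IX IY H n (\<lambda>i. Z i \<omega>) - (\<integral>\<omega>'. src_U m IX IY H n (\<lambda>i. Z i \<omega>') \<partial>M)))"
proof -
  have IX: "rank_indicator m IX" and IY: "rank_indicator m IY"
    and H: "subgroup H (sym_group m)" and eo: "equally_many_even_odd H"
    using src by (simp_all add: is_symmetric_rank_covariance_def)
  have order: "2 \<le> m" by (rule two_le_order[OF H eo])
  interpret M: prob_space M by fact
  interpret K: rank_kernel m IX IY H by (intro rank_kernel.intro IX IY H)
  let ?\<kappa> = "src_kappa m IX IY H"
  define DX where "DX = distr M borel X"
  define DY where "DY = distr M borel Y"
  define D where "D = DX \<Otimes>\<^sub>M DY"
  have DX: "prob_space DX" "sets DX = sets borel" and DY: "prob_space DY" "sets DY = sets borel"
    using M.prob_space_distr rv by (auto simp: DX_def DY_def)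
  \<comment> \<open>Independence of \<open>X\<close> and \<open>Y\<close> enters here: the common
    law of the observations is the product of the marginals.\<close>
  have D_eq: "D = distr M borel (\<lambda>\<omega>. (X \<omega>, Y \<omega>))"
    unfolding D_def DX_def DY_def by (rule distr_indep_rvs[OF M rv indep])
  then have sets_D: "sets D = sets borel" by simp
  interpret DX: prob_space DX by fact
  interpret DY: prob_space DY by fact
  interpret DXY: pair_prob_space DX DY ..
  have prob_D: "prob_space D" unfolding D_def by (rule DXY.prob_space_axioms)
  have Z: "M.indep_vars (\<lambda>_. borel) Z {1..}" and Z_law: "\<And>i. 1 \<le> i \<Longrightarrow> distr M borel (Z i) = D"
    using iid unfolding iid_copies_def D_eq by auto
  have Z_meas: "Z i \<in> measurable M D" if "1 \<le> i" for i
    using Z that unfolding M.indep_vars_def by (simp add: measurable_cong_sets[OF refl sets_D])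
  have law: "distr M (Pi\<^sub>M {1..n} (\<lambda>_. D)) (\<lambda>\<omega>. \<lambda>i\<in>{1..n}. Z i \<omega>) = Pi\<^sub>M {1..n} (\<lambda>_. D)" for n
    by (rule distr_iid_tuple[OF M Z Z_law])
  have coord: "(\<lambda>w. w j) \<in> borel_measurable (Pi\<^sub>M {1..m} (\<lambda>_. D))" if "j \<in> {1..m}" for j
    using measurable_component_singleton[OF that, of "\<lambda>_. D"]
    by (simp add: measurable_cong_sets[OF refl sets_D])
  have kappa_degenerate: "(\<integral>w. ?\<kappa> (w(q := a)) \<partial>Pi\<^sub>M {1..m} (\<lambda>_. D)) = 0" if "q \<in> {1..m}" for q a
    unfolding D_def by (rule K.integral_src_kappa_eq_0[OF DX DY G classes that])
  \<comment> \<open>The rank kernel is now an instance of the general degenerate kernel, with bound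
    \<open>(card H)\<^sup>2\<close>.\<close>
  interpret degenerate_kernel D m ?\<kappa> "(real (card H))\<^sup>2"
    by (intro degenerate_kernel.intro degenerate_kernel_axioms.intro prob_D order
        K.determined_on_src_kappa K.measurable_src_kappa coord K.abs_src_kappa_le kappa_degenerate)
  have "src_kappa1 m IX IY H M Z a = 0" for a
  proof -
    have Zm: "(\<lambda>\<omega>. \<lambda>i\<in>{1..m}. Z i \<omega>) \<in> measurable M (Pi\<^sub>M {1..m} (\<lambda>_. D))"
      using Z_meas by (intro measurable_restrict) simp
    have meas: "(\<lambda>w. ?\<kappa> (w(1 := a))) \<in> borel_measurable (Pi\<^sub>M {1..m} (\<lambda>_. D))"
    proof (rule K.measurable_src_kappa)
      show "(\<lambda>w. (w(1 := a)) j) \<in> borel_measurable (Pi\<^sub>M {1..m} (\<lambda>_. D))" if "j \<in> {1..m}" for j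
        using coord[OF that] by (cases "j = 1") auto
    qed
    \<comment> \<open>Only the first \<open>m\<close> entries matter, so the infinite sequence may
      be restricted and its joint law inserted; \<open>kappa_degenerate\<close> at position
      \<open>1\<close> finishes.\<close>
    have "src_kappa1 m IX IY H M Z a = (\<integral>\<omega>. ?\<kappa> ((\<lambda>i\<in>{1..m}. Z i \<omega>)(1 := a)) \<partial>M)"
      unfolding src_kappa1_def
      by (intro Bochner_Integration.integral_cong refl determined_onD[OF K.determined_on_src_kappa]) simp
    also have "\<dots> = (\<integral>w. ?\<kappa> (w(1 := a)) \<partial>Pi\<^sub>M {1..m} (\<lambda>_. D))"
      unfolding integral_distr[OF Zm meas, symmetric] law ..
    also have "\<dots> = 0" using order by (intro kappa_degenerate) simp
    finally show ?thesis .
  qed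
  moreover have "src_U m IX IY H = U"
    by (intro ext) (simp add: src_U_def U_def increasing_tuples_def)
  ultimately show ?thesis
    using U_tendsto[OF M Z_meas law] by simp
qed

end
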